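(* Let $d\ge 1$. (a) For every centrally symmetric smooth Fano polytope $\mathcal{P}\subset\mathbb{R}^d$ of dimension $d$ there exists a symmetric directed graph $G$, with $\widetilde{G}$ connected, such that $\widetilde{G}$ contains no even cycle and $\mathcal{P}_G$ is unimodularly equivalent to $\mathcal{P}$. (b) For every pseudo-symmetric smooth Fano polytope $\mathcal{P}\subset\mathbb{R}^d$ of dimension $d$ there exists a directed graph $G$, with $\widetilde{G}$ connected and every arrow of $G$ appearing in a directed cycle in $G$, such that $\widetilde{G}$ contains no even cycle and $\mathcal{P}_G$ is unimodularly equivalent to $\mathcal{P}$.
   Context: Fano polytopes: a Fano polytope $\mathcal{P}\subset\mathbb{R}^d$ is a $d$-dimensional convex polytope whose vertices have integer coordinates and such that the origin is the unique integer point in its interior. It is smooth if the vertices of each facet form a $\mathbb{Z}$-basis of $\mathbb{Z}^d$. It is centrally symmetric if $\mathcal{P}=-\mathcal{P}$, and pseudo-symmetric if there is a facet $\mathcal{F}$ of $\mathcal{P}$ such that $-\mathcal{F}$ is also a facet of $\mathcal{P}$. Directed graphs: $G$ is a finite directed graph on a vertex set $\{1,\ldots,n\}$ with arrow set $A(G)$ consisting of ordered pairs $(i,j)$ of distinct vertices; $(i,j)$ and $(j,i)$ are distinct arrows and both may belong to $A(G)$. $G$ is symmetric if $(i,j)\in A(G)$ implies $(j,i)\in A(G)$. The corresponding undirected graph $\widetilde{G}$ has the same vertex set and edge set $\{\{i,j\} : (i,j)\in A(G)\text{ or }(j,i)\in A(G)\}$; it is a simple graph, and an even cycle in it is a cycle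 of even length (so of length at least 4). A directed cycle in $G$ is a sequence of $l\ge 2$ pairwise distinct vertices $i_1,\ldots,i_l$ with $(i_j,i_{j+1})\in A(G)$ for all $1\le j\le l$, where $i_{l+1}=i_1$. The polytope $\mathcal{P}_G$: with $\mathbf{e}_1,\ldots,\mathbf{e}_n$ the standard basis of $\mathbb{R}^n$, $\mathcal{P}_G\subset\mathbb{R}^n$ is the convex hull of $\{\mathbf{e}_i-\mathbf{e}_j : (i,j)\in A(G)\}$. It lies in the hyperplane $\mathcal{H}=\{x\in\mathbb{R}^n : x_1+\cdots+x_n=0\}$ and is regarded as a polytope in $\mathcal{H}$ with lattice $\mathcal{H}\cap\mathbb{Z}^n$. That $\mathcal{P}_G$ is unimodularly equivalent to $\mathcal{P}\subset\mathbb{R}^d$ means that there is a linear isomorphism $\mathbb{R}^d\to\mathcal{H}$ (so $n=d+1$) mapping $\mathbb{Z}^d$ onto $\mathcal{H}\cap\mathbb{Z}^n$ and $\mathcal{P}$ onto $\mathcal{P}_G$. *)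

theory Defs
  imports "HOL-Analysis.Analysis" "Graph_Theory.Digraph_Component"
begin

section \<open>Smooth Fano polytopes\<close>

definition int_lattice :: "(real ^ 'm::finite) set" where
  "int_lattice = {x. \<forall>i. x $ i \<in> \<int>}"

definition vertices :: "'a::real_vector set \<Rightarrow> 'a set" where
  "vertices P = {v. v extreme_point_of P}"

text \<open>The guard \<open>\<forall>v. v \<notin> B \<longrightarrow> c v = 0\<close> makes the coefficient function unique off \<open>B\<close> as well.\<close>

definition is_Z_basis :: "'a::real_vector set \<Rightarrow> 'a set \<Rightarrow> bool" where
  "is_Z_basis B L \<longleftrightarrow> finite B \<and> B \<subseteq> L \<and>
     (\<forall>x\<in>L. \<exists>!c :: 'a \<Rightarrow> int. (\<forall>v. v \<notin> B \<longrightarrow> c v = 0) \<and> x = (\<Sum>v\<in>B. of_int (c v) *\<^sub>R v))"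

definition fano_polytope :: "(real ^ 'd::finite) set \<Rightarrow> bool" where
  "fano_polytope P \<longleftrightarrow> polytope P \<and> aff_dim P = int CARD('d) \<and>
     vertices P \<subseteq> int_lattice \<and> interior P \<inter> int_lattice = {0}"

definition smooth_fano_polytope :: "(real ^ 'd::finite) set \<Rightarrow> bool" where
  "smooth_fano_polytope P \<longleftrightarrow> fano_polytope P \<and>
     (\<forall>F. F facet_of P \<longrightarrow> is_Z_basis (vertices F) int_lattice)"

definition centrally_symmetric :: "'a::real_vector set \<Rightarrow> bool" where
  "centrally_symmetric P \<longleftrightarrow> P = uminus ` P"

definition pseudo_symmetric :: "'a::euclidean_space set \<Rightarrow> bool" where
  "pseudo_symmetric P \<longleftrightarrow> (\<exists>F. F facet_of P \<and> (uminus ` F) facet_of P)"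

section \<open>Directed graphs\<close>

text \<open>
  \<open>mk_symmetric G\<close> represents the simple undirected graph underlying \<open>G\<close>: every edge is
  replaced by its two orientations.  Its cycles of length at least 3 are the cycles of that
  simple graph; those of length 2 merely traverse one edge back and forth, so the bound
  \<open>4 \<le> length p\<close> removes exactly these among the even ones.
\<close>

definition has_even_cycle :: "'v pair_pre_digraph \<Rightarrow> bool" where
  "has_even_cycle G \<longleftrightarrow>
     (\<exists>p. pre_digraph.cycle (with_proj (mk_symmetric (with_proj G))) p \<and>
          even (length p) \<and> 4 \<le> length p)"

text \<open>For loop-free \<open>G\<close> the cycles below have length at least 2.\<close>

definition all_arcs_in_cycles :: "'v pair_pre_digraph \<Rightarrow> bool" where
  "all_arcs_in_cycles G \<longleftrightarrow>
     (\<forall>a\<in>parcs G. \<exists>p. pre_digraph.cycle (with_proj G) p \<and> a \<in> set p)"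

section \<open>The polytope of a directed graph\<close>

text \<open>The vertex set is the index type \<open>'n\<close> of the coordinates; \<open>axis i 1\<close> is the
  standard basis vector of \<open>i\<close>.\<close>

definition graph_polytope :: "'n::finite pair_pre_digraph \<Rightarrow> (real ^ 'n) set" where
  "graph_polytope G = convex hull {axis i 1 - axis j 1 |i j. (i, j) \<in> parcs G}"

definition zero_sum_hyperplane :: "(real ^ 'n::finite) set" where
  "zero_sum_hyperplane = {x. (\<Sum>i\<in>UNIV. x $ i) = 0}"

text \<open>
  Unimodular equivalence of a polytope \<open>P\<close> in the full space with a polytope \<open>Q\<close> regarded
  as lying in the hyperplane, with respect to the lattice of integer points of the hyperplane.
\<close>

definition unimodularly_equivalent ::
    "(real ^ 'd::finite) set \<Rightarrow> (real ^ 'n::finite) set \<Rightarrow> bool" where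
  "unimodularly_equivalent P Q \<longleftrightarrow>
     (\<exists>f :: real ^ 'd \<Rightarrow> real ^ 'n. linear f \<and> bij_betw f UNIV zero_sum_hyperplane \<and>
        f ` int_lattice = zero_sum_hyperplane \<inter> int_lattice \<and> f ` P = Q)"

end

theory Submission
  imports Defs
begin

text \<open>
  Let \<open>F\<close> and \<open>- F\<close> be opposite facets of a smooth Fano polytope.  The vertices of \<open>F\<close> form a
  \<open>\<int>\<close>-basis; use it as coordinate system.  The functional defining \<open>F\<close> becomes the coordinate sum,
  which lies between \<open>-1\<close> and \<open>1\<close> on the polytope, so every vertex other than
  \<open>\<plusminus>e\<^sub>1, \<dots>, \<plusminus>e\<^sub>d\<close> has coordinate sum \<open>0\<close>.  Everything else about these remaining vertices
  follows from one property of a smooth polytope: among the vertices on a supporting hyperplane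
  avoiding the origin, each can be separated from all the others by an integral functional with
  values \<open>1\<close> and \<open>0\<close>, because all of them belong to one \<open>\<int>\<close>-basis.

  Tilting the supporting hyperplane of \<open>F\<close> around the ridge opposite to \<open>e\<^sub>i\<close> until it meets a new
  vertex shows that a vertex of coordinate sum \<open>0\<close> has entries in \<open>{-1, 0, 1}\<close> only, and that each
  position carries the entry \<open>-1\<close> in at most one such vertex (\<open>negative_coordinate_unique\<close>); by
  symmetry the same holds for the entry \<open>1\<close>.  If two such vertices \<open>v\<close> and \<open>w\<close> have opposite entries
  in a common position but \<open>w \<noteq> - v\<close>, one can write down a supporting hyperplane with coefficients
  \<open>\<plusminus>1\<close> apart from one \<open>0\<close> that contains both of them together with \<open>d - 1\<close> of the vertices \<open>\<plusminus>e\<^sub>l\<close>,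
  and these vertices are linearly dependent (\<open>opposite_signs_imp_negatives\<close>).  Hence the supports
  are disjoint blocks of even size, each carrying one vertex or a pair \<open>\<plusminus>v\<close>, and after changing the
  signs of coordinates the vertices are \<open>\<plusminus>e\<^sub>i\<close>, the indicator vectors of the blocks, and the
  negatives of some of them (\<open>pseudo_symmetric_classification\<close>).

  For the graph, order the coordinates so that every block is an interval and map \<open>e\<^sub>i\<close> to the
  \<open>i\<close>-th edge of a directed path through all \<open>d + 1\<close> nodes.  The indicator vector of a block then
  telescopes to the chord joining the ends of the interval.  The resulting graph is a path,
  traversable both ways, with chords over nonoverlapping intervals of even length.  It is strongly
  connected, so each arc lies in a directed cycle, and its only undirected cycles close up
  one chord with the path below it; these have odd length.  If the polytope is centrally symmetric,
  then so is its set of vertices, and this is the symmetry of the graph.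
\<close>

section \<open>Lattice points and coordinate sums\<close>

text \<open>
  This is what smoothness contributes: the points of \<open>W\<close> on a supporting hyperplane \<open>u \<bullet> y = 1\<close> all
  belong to one \<open>\<int>\<close>-basis, whose dual basis supplies the functionals \<open>\<phi>\<close>.  Unlike the facets, the
  property refers only to the vertex set and is visibly invariant under lattice isomorphisms.
\<close>

definition integral_dual_property :: "(real ^ 'd::finite) set \<Rightarrow> bool" where
  "integral_dual_property W \<longleftrightarrow>
     (\<forall>u x. (\<forall>y\<in>W. u \<bullet> y \<le> 1) \<longrightarrow> x \<in> W \<longrightarrow> u \<bullet> x = 1 \<longrightarrow>
        (\<exists>\<phi>\<in>int_lattice. \<phi> \<bullet> x = 1 \<and> (\<forall>y\<in>W. u \<bullet> y = 1 \<longrightarrow> y \<noteq> x \<longrightarrow> \<phi> \<bullet> y = 0)))"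

definition coord_sum :: "real ^ 'd::finite \<Rightarrow> real" where
  "coord_sum x = (\<Sum>i\<in>UNIV. x $ i)"

lemma coord_sum_simps [simp]:
  "coord_sum (axis i c) = c" "coord_sum (- x) = - coord_sum x" "coord_sum 0 = 0"
  "coord_sum (x + y) = coord_sum x + coord_sum y"
  by (simp_all add: coord_sum_def axis_def sum_negf sum.distrib)

lemma coord_sum_inner: "coord_sum x = 1 \<bullet> x"
  by (simp add: coord_sum_def inner_vec_def)

lemma inner_axis_left: "axis i c \<bullet> x = c * x $ i" for x :: "real ^ 'd::finite"
  by (simp add: inner_axis' )

lemma int_lattice_coord: "x \<in> int_lattice \<Longrightarrow> x $ i \<in> \<int>"
  by (simp add: int_lattice_def)

lemma int_lattice_uminus: "- x \<in> int_lattice \<longleftrightarrow> x \<in> int_lattice"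
  by (simp add: int_lattice_def)

definition supp :: "real ^ 'd::finite \<Rightarrow> 'd set" where
  "supp x = {i. x $ i \<noteq> 0}"

section \<open>Signed blocks\<close>

definition ind_vec :: "'d set \<Rightarrow> real ^ 'd::finite" where
  "ind_vec X = (\<chi> i. of_bool (i \<in> X))"

text \<open>
  Each block \<open>X \<in> C\<close> contributes its indicator vector, and those in \<open>C'\<close> contribute its negative as
  well.  A block of size \<open>2 k\<close> accounts for a del Pezzo polytope of dimension \<open>2 k\<close> if it lies in \<open>C'\<close>
  and for a pseudo del Pezzo polytope otherwise; a coordinate outside all blocks accounts for a
  segment.
\<close>

definition block_vertices :: "'d set set \<Rightarrow> 'd set set \<Rightarrow> (real ^ 'd::finite) set" where
  "block_vertices C C' = range (\<lambda>i. axis i 1) \<union> range (\<lambda>i. - axis i 1) \<union>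
     ind_vec ` C \<union> (\<lambda>X. - ind_vec X) ` C'"

definition even_blocks :: "'d set set \<Rightarrow> 'd set set \<Rightarrow> bool" where
  "even_blocks C C' \<longleftrightarrow> disjoint C \<and> C' \<subseteq> C \<and> (\<forall>X\<in>C. X \<noteq> {} \<and> even (card X))"

definition flip_signs :: "('d \<Rightarrow> real) \<Rightarrow> real ^ 'd \<Rightarrow> real ^ 'd::finite" where
  "flip_signs s x = (\<chi> i. s i * x $ i)"

section \<open>Vertex sets with two opposite unimodular facets\<close>

text \<open>
  \<open>W\<close> plays the vertex set of a smooth Fano polytope in the coordinates given by the vertices of a
  facet \<open>F\<close> such that \<open>- F\<close> is a facet too.
\<close>

locale opposite_facets =
  fixes W :: "(real ^ 'd::finite) set"
  assumes finite_W: "finite W"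
    and integral: "W \<subseteq> int_lattice"
    and nonzero: "0 \<notin> W"
    and axis_mem: "axis i 1 \<in> W"
    and neg_axis_mem: "- axis i 1 \<in> W"
    and sum_le: "x \<in> W \<Longrightarrow> coord_sum x \<le> 1"
    and sum_ge: "x \<in> W \<Longrightarrow> - 1 \<le> coord_sum x"
    and sum_eq_1: "x \<in> W \<Longrightarrow> coord_sum x = 1 \<Longrightarrow> x \<in> range (\<lambda>i. axis i 1)"
    and sum_eq_neg_1: "x \<in> W \<Longrightarrow> coord_sum x = - 1 \<Longrightarrow> x \<in> range (\<lambda>i. - axis i 1)"
    and dual: "integral_dual_property W"
begin

text \<open>
  Exchanging the two facets turns each result on negative coordinates into one on positive ones.
\<close>

lemma negated: "opposite_facets (uminus ` W)"
proof
  show "finite (uminus ` W)" using finite_W by simp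
  show "uminus ` W \<subseteq> int_lattice" using integral by (auto simp: int_lattice_uminus)
  show "0 \<notin> uminus ` W" using nonzero by auto
  show "axis i 1 \<in> uminus ` W" for i
    using neg_axis_mem[of i] by (metis imageI minus_minus)
  show "- axis i 1 \<in> uminus ` W" for i
    using axis_mem[of i] by blast
  show "coord_sum x \<le> 1" if "x \<in> uminus ` W" for x using that sum_ge by force
  show "-1 \<le> coord_sum x" if "x \<in> uminus ` W" for x using that sum_le by force
  show "x \<in> range (\<lambda>i. axis i 1)" if "x \<in> uminus ` W" "coord_sum x = 1" for x
    using that sum_eq_neg_1[of "-x"] by auto
  show "x \<in> range (\<lambda>i. - axis i 1)" if "x \<in> uminus ` W" "coord_sum x = - 1" for x
    using that sum_eq_1[of "-x"] by auto
  show "integral_dual_property (uminus ` W)"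
    unfolding integral_dual_property_def
  proof (intro allI impI)
    fix u x assume u: "\<forall>y\<in>uminus ` W. u \<bullet> y \<le> 1" and x: "x \<in> uminus ` W" "u \<bullet> x = 1"
    have "\<forall>y\<in>W. (-u) \<bullet> y \<le> 1" "-x \<in> W" "(-u) \<bullet> (-x) = 1" using u x by auto
    then obtain \<phi> where \<phi>: "\<phi> \<in> int_lattice" "\<phi> \<bullet> (-x) = 1"
      "\<forall>y\<in>W. (-u) \<bullet> y = 1 \<longrightarrow> y \<noteq> -x \<longrightarrow> \<phi> \<bullet> y = 0"
      using dual unfolding integral_dual_property_def by blast
    show "\<exists>\<phi>\<in>int_lattice. \<phi> \<bullet> x = 1 \<and> (\<forall>y\<in>uminus ` W. u \<bullet> y = 1 \<longrightarrow> y \<noteq> x \<longrightarrow> \<phi> \<bullet> y = 0)"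
      using \<phi> by (intro bexI[of _ "-\<phi>"]) (auto simp: int_lattice_uminus)
  qed
qed

lemma coord_sum_cases:
  assumes "x \<in> W"
  shows "x \<in> range (\<lambda>i. axis i 1) \<or> x \<in> range (\<lambda>i. - axis i 1) \<or> coord_sum x = 0"
proof -
  have "coord_sum x \<in> \<int>"
    unfolding coord_sum_def using assms integral int_lattice_coord by (intro Ints_sum) auto
  then obtain k where k: "coord_sum x = of_int k" by (auto elim: Ints_cases)
  with sum_le[OF assms] sum_ge[OF assms] have "k \<le> 1" "k \<ge> -1" by linarith+
  then have "k = 1 \<or> k = -1 \<or> k = 0" by auto
  with k sum_eq_1 sum_eq_neg_1 assms show ?thesis by auto
qed

lemma tight_dual:
  assumes "\<And>y. y \<in> W \<Longrightarrow> u \<bullet> y \<le> 1" "x \<in> W" "u \<bullet> x = 1"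
  obtains \<phi> where "\<phi> \<in> int_lattice" "\<phi> \<bullet> x = 1"
    "\<And>y. y \<in> W \<Longrightarrow> u \<bullet> y = 1 \<Longrightarrow> y \<noteq> x \<Longrightarrow> \<phi> \<bullet> y = 0"
  using assms dual unfolding integral_dual_property_def by (metis (full_types))

text \<open>
  Rotate the hyperplane of the facet spanned by the unit vectors about the ridge of those different
  from \<open>e\<^sub>i\<close>, by decreasing the \<open>i\<close>-th coefficient until the first vertex \<open>m\<close> with negative \<open>i\<close>-th
  coordinate is met.  Integrality of a dual functional forces \<open>m\<^sub>i = -1\<close>, hence the rotation
  parameter \<open>t\<close> is at least \<open>1\<close>; but every vertex of sum \<open>0\<close> with negative \<open>i\<close>-th coordinate
  is already met when \<open>t\<close> reaches \<open>1\<close>.  So all of these are met simultaneously with \<open>m\<close>, and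
  the neighbouring facet has room for one vertex only.
\<close>

lemma negative_coordinate_unique:
  assumes x: "x \<in> W" "coord_sum x = 0" "x $ i < 0"
  and y: "y \<in> W" "coord_sum y = 0" "y $ i < 0"
  shows "x $ i = - 1 \<and> y = x"
proof -
  define N where "N = {z \<in> W. z $ i < 0}"
  define r where "r z = (1 - coord_sum z) / (- z $ i)" for z :: "real ^ 'd"
  \<comment> \<open>The hyperplane \<open>coord_sum y - t * y $ i = 1\<close> meets \<open>z\<close> for the parameter \<open>t = r z\<close>.\<close>
  define t where "t = Min (r ` N)"
  have fin: "finite (r ` N)" and ne: "r ` N \<noteq> {}"
    using finite_W x by (auto simp: N_def)
  obtain m where m: "m \<in> N" "r m = t"
    using Min_in[OF fin ne] unfolding t_def by auto
  have tle: "t \<le> r z" if "z \<in> N" for z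
    unfolding t_def using that fin by auto
  define u where "u = 1 - axis i t"
  have u: "u \<bullet> z = coord_sum z - t * z $ i" for z
    by (simp add: u_def inner_diff_left coord_sum_inner inner_axis_left)
  have sum_nonpos: "coord_sum z \<le> 0" if "z \<in> N" for z
  proof -
    have "z \<notin> range (\<lambda>i. axis i 1)" using that by (auto simp: N_def axis_def split: if_splits)
    then show ?thesis using coord_sum_cases[of z] that by (auto simp: N_def)
  qed
  have t0: "t \<ge> 0"
    using m sum_nonpos[of m] by (auto simp: r_def N_def intro!: divide_nonneg_neg)
  have uN: "u \<bullet> z = 1 \<longleftrightarrow> r z = t" "u \<bullet> z \<le> 1" if "z \<in> N" for z
    using that tle[OF that] unfolding u r_def N_def by (auto simp: field_simps)
  have ule: "u \<bullet> z \<le> 1" if "z \<in> W" for z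
  proof (cases "z \<in> N")
    case False
    then have "t * z $ i \<ge> 0" using t0 that by (auto simp: N_def)
    then show ?thesis unfolding u using sum_le[OF that] by linarith
  qed (rule uN)
  have mW: "m \<in> W" "m $ i < 0" using m by (auto simp: N_def)
  obtain \<phi> where \<phi>: "\<phi> \<in> int_lattice" "\<phi> \<bullet> m = 1"
    "\<And>y. y \<in> W \<Longrightarrow> u \<bullet> y = 1 \<Longrightarrow> y \<noteq> m \<Longrightarrow> \<phi> \<bullet> y = 0"
    using tight_dual[OF ule mW(1)] uN(1)[OF m(1)] m(2) by metis
  have \<phi>0: "\<phi> $ j = 0" if "j \<noteq> i" for j
  proof -
    have "axis j 1 \<noteq> m" using mW that by (auto simp: axis_def)
    moreover have "u \<bullet> axis j 1 = 1" using that by (simp add: u) (simp add: axis_def)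
    ultimately show ?thesis using \<phi>(3)[OF axis_mem[of j]] by (simp add: inner_axis)
  qed
  have \<phi>in: "\<phi> \<bullet> z = \<phi> $ i * z $ i" for z
    by (subst inner_vec_def, subst sum.remove[of _ i]) (auto simp: \<phi>0 intro!: sum.neutral)
  have "\<phi> $ i \<in> \<int>" "m $ i \<in> \<int>"
    using \<phi>(1) mW integral by (auto simp: int_lattice_def)
  then obtain a b :: int where ab: "\<phi> $ i = of_int a" "m $ i = of_int b"
    by (auto elim!: Ints_cases)
  have "a * b = 1" using \<phi>(2) unfolding \<phi>in ab by (metis of_int_mult of_int_eq_1_iff)
  moreover have "b < 0" using mW ab by simp
  ultimately have mi: "m $ i = -1" using ab by (auto simp: zmult_eq_1_iff)
  have t1: "t \<ge> 1" using m(2) sum_nonpos[OF m(1)] mi by (auto simp: r_def)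
  have eq: "z = m" if z: "z \<in> W" "coord_sum z = 0" "z $ i < 0" for z
  proof -
    have zN: "z \<in> N" using z by (simp add: N_def)
    have "z $ i \<in> \<int>" using z integral by (auto simp: int_lattice_def)
    then obtain c where c: "z $ i = of_int c" by (auto elim: Ints_cases)
    with z have "z $ i \<le> -1" by auto
    then have "r z \<le> 1" using z by (simp add: r_def field_simps)
    then have "r z = t" using t1 tle[OF zN] by linarith
    then have "u \<bullet> z = 1" using uN zN by simp
    then show ?thesis using \<phi>(3)[OF z(1)] \<phi>in[of z] z ab \<open>a * b = 1\<close> by (cases "z = m") auto
  qed
  show ?thesis using eq[OF x] eq[OF y] mi by simp
qed

text \<open>
  The hyperplane \<open>u \<bullet> y = 1\<close> contains \<open>v\<close>, \<open>w\<close> and one of \<open>\<plusminus>e\<^sub>l\<close> for each \<open>l \<noteq> i\<close>.  Since \<open>v + w\<close> is a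
  combination of the latter, these points are linearly dependent, whereas the vertices of a face are
  independent.
\<close>

lemma degenerate_face_impossible:
  assumes le: "\<And>y. y \<in> W \<Longrightarrow> coord_sum y = 0 \<Longrightarrow> u \<bullet> y \<le> 1"
    and pm1: "\<And>l. l \<noteq> i \<Longrightarrow> \<bar>u $ l\<bar> = 1" and ui: "\<bar>u $ i\<bar> \<le> 1"
    and v: "v \<in> W" "coord_sum v = 0" "u \<bullet> v = 1"
    and w: "w \<in> W" "coord_sum w = 0" "u \<bullet> w = 1"
    and cancel: "v $ i + w $ i = 0"
  shows "v = w"
proof (rule ccontr)
  assume "v \<noteq> w"
  have ule: "u \<bullet> y \<le> 1" if "y \<in> W" for y
  proof -
    have "\<bar>u $ l\<bar> \<le> 1" for l using pm1[of l] ui by (cases "l = i") auto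
    then have "u $ l \<le> 1" "- u $ l \<le> 1" for l by (smt (verit))+
    then show ?thesis using coord_sum_cases[OF that] le[OF that] by (auto simp: inner_axis)
  qed
  obtain \<phi> where "\<phi> \<in> int_lattice" and \<phi>: "\<phi> \<bullet> v = 1" "\<And>y. y \<in> W \<Longrightarrow> u \<bullet> y = 1 \<Longrightarrow> y \<noteq> v \<Longrightarrow> \<phi> \<bullet> y = 0"
    using tight_dual[OF ule v(1) v(3)] by metis
  have "\<phi> $ l = 0" if "l \<noteq> i" for l
  proof -
    have ne: "axis l 1 \<noteq> v" "- axis l 1 \<noteq> v"
      using v(2) by (metis coord_sum_simps(1) zero_neq_one)
        (metis v(2) coord_sum_simps(1,2) zero_neq_neg_one)
    have "u $ l = 1 \<or> u $ l = -1" using pm1[OF that] by linarith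
    then show ?thesis
      using \<phi>(2)[OF axis_mem[of l]] \<phi>(2)[OF neg_axis_mem[of l]] ne by (auto simp: inner_axis)
  qed
  then have "\<phi> \<bullet> (v + w) = \<phi> $ i * (v + w) $ i"
    by (subst inner_vec_def, subst sum.remove[of _ i]) (auto intro!: sum.neutral)
  moreover have "\<phi> \<bullet> (v + w) = 1"
    using \<phi>(1) \<phi>(2)[OF w(1,3)] \<open>v \<noteq> w\<close> by (simp add: inner_add_right)
  ultimately show False using cancel by simp
qed

lemma positive_coordinate_unique:
  assumes "x \<in> W" "coord_sum x = 0" "x $ i > 0" "y \<in> W" "coord_sum y = 0" "y $ i > 0"
  shows "x $ i = 1 \<and> y = x"
proof -
  have "(-x) $ i = - 1 \<and> - y = - x"
    by (rule opposite_facets.negative_coordinate_unique[OF negated]) (use assms in auto)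
  then show ?thesis by auto
qed

lemma coordinate_cases:
  assumes "x \<in> W" "coord_sum x = 0"
  shows "x $ i = 0 \<or> x $ i = 1 \<or> x $ i = -1"
  using negative_coordinate_unique[of x i x] positive_coordinate_unique[of x i x] assms by linarith

text \<open>
  Think of the vertices of sum \<open>0\<close> as nodes, and of each coordinate as an arc from the node where its
  entry is \<open>-1\<close> to the node where it is \<open>1\<close>; one additional node supplies missing ends.
  Vanishing coordinate sums mean that in-degrees equal out-degrees, and \<open>i\<close> is an arc from \<open>w\<close>
  to \<open>v\<close>.  Starting from the all-one functional, deleting the arc \<open>i\<close> and reversing a path from
  \<open>v\<close> to any node other than \<open>v\<close> and \<open>w\<close> yields a functional with value \<open>1\<close> on \<open>v\<close> and \<open>w\<close>
  and at most \<open>0\<close> on the other vertices of sum \<open>0\<close>, which \<open>degenerate_face_impossible\<close> excludes.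
  A path of length one (an arc \<open>j\<close>) or two (arcs \<open>j\<close>, \<open>k\<close> through \<open>w\<close>) exists unless all arcs
  leaving \<open>v\<close> lead to \<open>w\<close> and conversely, in which case \<open>v + w = 0\<close>.
\<close>

lemma opposite_signs_imp_negatives:
  assumes v: "v \<in> W" "coord_sum v = 0" "v $ i = 1"
    and w: "w \<in> W" "coord_sum w = 0" "w $ i = - 1"
  shows "w = - v"
proof (rule ccontr)
  assume neg: "w \<noteq> - v"
  have vw: "v \<noteq> w" using v w by auto
  have neg1: "y = x" if "x \<in> W" "coord_sum x = 0" "x $ l = -1" "y \<in> W" "coord_sum y = 0" "y $ l = -1"
    for x y l using negative_coordinate_unique[of x l y] that by auto
  have pos1: "y = x" if "x \<in> W" "coord_sum x = 0" "x $ l = 1" "y \<in> W" "coord_sum y = 0" "y $ l = 1"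
    for x y l using positive_coordinate_unique[of x l y] that by auto
  have other: "y $ i = 0" if "y \<in> W" "coord_sum y = 0" "y \<noteq> v" "y \<noteq> w" for y
    using coordinate_cases[OF that(1,2)] neg1[OF w that(1,2)] pos1[OF v that(1,2)] that by metis
  show False
  proof (cases "\<exists>j. v $ j = -1 \<and> w $ j \<noteq> 1")
    case True
    then obtain j where j: "v $ j = -1" "w $ j \<noteq> 1" by auto
    have ji: "j \<noteq> i" using j v by auto
    have wj: "w $ j = 0" using coordinate_cases[OF w(1,2), of j] neg1[OF v(1,2) j(1) w(1,2)] j vw by metis
    \<comment> \<open>Delete the arc \<open>i\<close> and reverse the arc \<open>j\<close>.\<close>
    define u :: "real ^ 'd" where "u = 1 - axis i 1 - axis j 2"
    have u: "u \<bullet> y = coord_sum y - y $ i - 2 * y $ j" for y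
      by (simp add: u_def inner_diff_left coord_sum_inner inner_axis_left)
    have uv: "u \<bullet> v = 1" and uw: "u \<bullet> w = 1" using v w j wj by (simp_all add: u)
    have le: "u \<bullet> y \<le> 1" if y: "y \<in> W" "coord_sum y = 0" for y
    proof (cases "y = v \<or> y = w")
      case False
      then have "y $ i = 0" using other y by blast
      moreover have "y $ j \<noteq> -1" using neg1[OF v(1,2) j(1) y] False by auto
      then have "y $ j \<ge> 0" using coordinate_cases[OF y, of j] by auto
      ultimately show ?thesis using y by (simp add: u)
    qed (use uv uw in auto)
    have "v = w"
      by (rule degenerate_face_impossible[of u i])
        (use le uv uw v w ji in \<open>auto simp: u_def axis_def\<close>)
    then show False using vw by simp
  next
    case False
    then have J: "w $ l = 1" if "v $ l = -1" for l using that by blast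
    have "\<exists>k. w $ k = -1 \<and> v $ k \<noteq> 1"
    proof (rule ccontr)
      assume "\<nexists>k. w $ k = -1 \<and> v $ k \<noteq> 1"
      then have "(v + w) $ l \<ge> 0" for l
        using J coordinate_cases[OF v(1,2), of l] coordinate_cases[OF w(1,2), of l] by force
      moreover have "(\<Sum>l\<in>UNIV. (v + w) $ l) = 0"
        using v w coord_sum_simps(4)[of v w] by (simp add: coord_sum_def)
      ultimately have "(v + w) $ l = 0" for l
        by (subst (asm) sum_nonneg_eq_0_iff) auto
      then have "v + w = 0" by (simp add: vec_eq_iff)
      then show False using neg by (simp add: add_eq_0_iff)
    qed
    then obtain k where k: "w $ k = -1" "v $ k \<noteq> 1" by auto
    have vk: "v $ k = 0" using coordinate_cases[OF v(1,2), of k] neg1[OF v(1,2) _ w(1,2) k(1)] k vw by metis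
    have "\<exists>j. v $ j = -1"
    proof (rule ccontr)
      assume "\<nexists>j. v $ j = -1"
      then have "v $ l \<ge> 0" for l using coordinate_cases[OF v(1,2), of l] by auto
      then have "v $ i = 0" using v(2) unfolding coord_sum_def
        by (subst (asm) sum_nonneg_eq_0_iff) auto
      then show False using v by simp
    qed
    then obtain j where j: "v $ j = -1" by blast
    have wj: "w $ j = 1" using J j by blast
    have ne: "i \<noteq> j" "i \<noteq> k" "j \<noteq> k" using v w j wj k vk by auto
    \<comment> \<open>Delete the arc \<open>i\<close> and reverse the arcs \<open>j\<close> and \<open>k\<close>.\<close>
    define u :: "real ^ 'd" where "u = 1 - axis i 1 - axis j 2 - axis k 2"
    have u: "u \<bullet> y = coord_sum y - y $ i - 2 * y $ j - 2 * y $ k" for y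
      by (simp add: u_def inner_diff_left coord_sum_inner inner_axis_left)
    have uv: "u \<bullet> v = 1" and uw: "u \<bullet> w = 1" using v w j wj k vk by (simp_all add: u)
    have le: "u \<bullet> y \<le> 1" if y: "y \<in> W" "coord_sum y = 0" for y
    proof (cases "y = v \<or> y = w")
      case False
      then have "y $ i = 0" using other y by blast
      moreover have "y $ j = 0"
        using coordinate_cases[OF y, of j] neg1[OF v(1,2) j y] pos1[OF w(1,2) wj y] False by metis
      moreover have "y $ k \<noteq> -1" using neg1[OF w(1,2) k(1) y] False by auto
      then have "y $ k \<ge> 0" using coordinate_cases[OF y, of k] by auto
      ultimately show ?thesis using y by (simp add: u)
    qed (use uv uw in auto)
    have "v = w"
      by (rule degenerate_face_impossible[of u i])
        (use le uv uw v w ne in \<open>auto simp: u_def axis_def\<close>)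
    then show False using vw by simp
  qed
qed

lemma supports_disjoint_or_parallel:
  assumes v: "v \<in> W" "coord_sum v = 0" and w: "w \<in> W" "coord_sum w = 0"
    and "supp v \<inter> supp w \<noteq> {}"
  shows "w = v \<or> w = - v"
proof -
  obtain i where i: "v $ i \<noteq> 0" "w $ i \<noteq> 0" using assms by (auto simp: supp_def)
  then consider "v $ i = 1" "w $ i = 1" | "v $ i = -1" "w $ i = -1"
    | "v $ i = 1" "w $ i = -1" | "v $ i = -1" "w $ i = 1"
    using coordinate_cases[OF v] coordinate_cases[OF w] by metis
  then show ?thesis
  proof cases
    case 1 then show ?thesis using positive_coordinate_unique[of v i w] v w by simp
  next
    case 2 then show ?thesis using negative_coordinate_unique[of v i w] v w by simp
  next
    case 3 then show ?thesis using opposite_signs_imp_negatives v w by blast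
  next
    case 4 then show ?thesis using opposite_signs_imp_negatives[OF w _ v] by (metis minus_minus)
  qed
qed

lemma supp_even:
  assumes v: "v \<in> W" "coord_sum v = 0"
  shows "even (card (supp v))" "supp v \<noteq> {}"
proof -
  have "real (card (supp v)) = (\<Sum>i\<in>supp v. 1)" by simp
  also have "\<dots> = (\<Sum>i\<in>supp v. 1) + (\<Sum>i\<in>supp v. v $ i)"
  proof -
    have "(\<Sum>i\<in>supp v. v $ i) = coord_sum v"
      unfolding coord_sum_def by (rule sum.mono_neutral_left) (auto simp: supp_def)
    then show ?thesis using v by simp
  qed
  also have "\<dots> = (\<Sum>i\<in>supp v. 2 * of_bool (v $ i = 1))"
    unfolding sum.distrib[symmetric]
    using coordinate_cases[OF v] by (intro sum.cong) (force simp: supp_def)+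
  also have "\<dots> = real (2 * (\<Sum>i\<in>supp v. of_bool (v $ i = 1)))"
    by (simp add: sum_distrib_left)
  finally have "card (supp v) = 2 * (\<Sum>i\<in>supp v. of_bool (v $ i = 1))"
    by (simp only: of_nat_eq_iff)
  then show "even (card (supp v))" by simp
  show "supp v \<noteq> {}" using v nonzero by (auto simp: supp_def vec_eq_iff) (metis vec_eq_iff zero_index)
qed

text \<open>
  Two vertices with intersecting supports agree up to sign, so one vertex \<open>r X\<close> chosen for each
  support \<open>X\<close> prescribes consistent sign changes that turn it into the indicator vector of \<open>X\<close>.
\<close>

lemma sign_normal_form:
  obtains s C C' where "\<And>i. s i = 1 \<or> s i = -1" "even_blocks C C'"
    "flip_signs s ` W = block_vertices C C'"
proof -
  define W0 where "W0 = {x \<in> W. coord_sum x = 0}"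
  define C where "C = supp ` W0"
  have "\<exists>r. \<forall>X\<in>C. r X \<in> W0 \<and> supp (r X) = X"
    unfolding C_def by (intro bchoice) auto
  then obtain r where r: "\<And>X. X \<in> C \<Longrightarrow> r X \<in> W0" "\<And>X. X \<in> C \<Longrightarrow> supp (r X) = X"
    by blast
  define C' where "C' = {X \<in> C. - r X \<in> W0}"
  have disj: "X = Y" if "X \<in> C" "Y \<in> C" "i \<in> X" "i \<in> Y" for X Y i
  proof -
    have "r Y = r X \<or> r Y = - r X"
      by (rule supports_disjoint_or_parallel) (use r that in \<open>auto simp: W0_def\<close>)
    then have "supp (r Y) = supp (r X)" by (auto simp: supp_def)
    then show ?thesis using r that by simp
  qed
  define s where "s i = (if \<exists>X\<in>C. i \<in> X then r (THE X. X \<in> C \<and> i \<in> X) $ i else 1)" for i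
  have s: "s i = r X $ i" if "X \<in> C" "i \<in> X" for X i
  proof -
    have "(THE X. X \<in> C \<and> i \<in> X) = X"
      by (rule the_equality) (use that disj in auto)
    then show ?thesis using that by (auto simp: s_def)
  qed
  have r1: "r X $ i = 1 \<or> r X $ i = -1" if "X \<in> C" "i \<in> X" for X i
    using coordinate_cases[of "r X" i] r[of X] that by (auto simp: W0_def supp_def)
  have s1: "s i = 1 \<or> s i = -1" for i
  proof (cases "\<exists>X\<in>C. i \<in> X")
    case True then show ?thesis using s r1 by metis
  qed (simp add: s_def)
  have blocks: "even_blocks C C'"
    unfolding even_blocks_def
  proof (intro conjI ballI)
    show "disjoint C" using disj by (auto simp: disjoint_def)
    show "C' \<subseteq> C" by (auto simp: C'_def)
  qed (auto simp: C_def W0_def supp_even)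
  have flip_r: "flip_signs s (r X) = ind_vec X" if "X \<in> C" for X
  proof -
    have "s i * r X $ i = of_bool (i \<in> X)" for i
      using s[OF that, of i] r1[OF that, of i] r(2)[OF that] by (auto simp: supp_def)
    then show ?thesis by (simp add: flip_signs_def ind_vec_def)
  qed
  have flip_neg: "flip_signs s (- x) = - flip_signs s x" for x by (simp add: flip_signs_def vec_eq_iff)
  have flip_axis: "flip_signs s (axis i c) = axis i (s i * c)" for i c
    by (simp add: flip_signs_def axis_def vec_eq_iff)
  have axes: "axis i (s i) \<in> flip_signs s ` W" "- axis i (s i) \<in> flip_signs s ` W" for i
    using flip_axis[of i 1] flip_neg[of "axis i 1"] axis_mem[of i] neg_axis_mem[of i]
    by (metis image_eqI mult.right_neutral)+
  have neg_axis: "axis i (-1) = - (axis i 1 :: real ^ 'd)" for i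
    by (simp add: axis_def vec_eq_iff)
  have "flip_signs s x \<in> block_vertices C C'" if x: "x \<in> W" for x
    using coord_sum_cases[OF x]
  proof (elim disjE rangeE)
    fix i assume "x = axis i 1" then show ?thesis
      using s1[of i] by (auto simp: flip_axis neg_axis block_vertices_def)
  next
    fix i assume "x = - axis i 1" then show ?thesis
      using s1[of i] by (auto simp: flip_axis flip_neg neg_axis block_vertices_def)
  next
    assume "coord_sum x = 0"
    then have x0: "x \<in> W0" using x by (simp add: W0_def)
    define X where "X = supp x"
    have X: "X \<in> C" using x0 by (auto simp: C_def X_def)
    have "x = r X \<or> x = - r X"
      by (rule supports_disjoint_or_parallel)
        (use r[OF X] x0 supp_even(2)[of x] in \<open>auto simp: W0_def X_def\<close>)
    moreover have "X \<in> C'" if "x = - r X" using that X x0 by (auto simp: C'_def)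
    ultimately show ?thesis
      using flip_r[OF X] X by (auto simp: flip_neg block_vertices_def)
  qed
  moreover have "z \<in> flip_signs s ` W" if "z \<in> block_vertices C C'" for z
    using that unfolding block_vertices_def
  proof (elim UnE imageE)
    fix i assume "z = axis i 1" then show ?thesis using axes[of i] s1[of i] by (metis neg_axis minus_minus)
  next
    fix i assume "z = - axis i 1" then show ?thesis using axes[of i] s1[of i] by (metis neg_axis minus_minus)
  next
    fix X assume "z = ind_vec X" "X \<in> C" then show ?thesis
      using flip_r[of X] r(1)[of X] by (auto simp: W0_def intro!: image_eqI[of _ _ "r X"])
  next
    fix X assume "z = - ind_vec X" "X \<in> C'" then show ?thesis
      using flip_r[of X] flip_neg[of "r X"]
      by (auto simp: C'_def W0_def intro!: image_eqI[of _ _ "- r X"])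
  qed
  ultimately have "flip_signs s ` W = block_vertices C C'" by blast
  with s1 blocks show thesis by (rule that)
qed

end

section \<open>Integral bases\<close>

definition lattice_iso :: "(real ^ 'd::finite \<Rightarrow> real ^ 'd) \<Rightarrow> bool" where
  "lattice_iso g \<longleftrightarrow> linear g \<and> bij g \<and> g ` int_lattice = int_lattice"

lemma axis_int_lattice: "axis k 1 \<in> int_lattice"
  by (simp add: int_lattice_def axis_def)

lemma inner_int_lattice: "x \<in> int_lattice \<Longrightarrow> y \<in> int_lattice \<Longrightarrow> x \<bullet> y \<in> \<int>"
  by (auto simp: inner_vec_def int_lattice_def intro!: Ints_sum Ints_mult)

text \<open>
  The \<open>k\<close>-th component of the dual vector of \<open>b\<close> is the coefficient of \<open>b\<close> in the expansion of the
  \<open>k\<close>-th unit vector.  Expanding \<open>b'\<close> through the unit vectors and comparing with its trivial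
  expansion gives the orthogonality relations, by uniqueness of coefficients.
\<close>

lemma Z_basis_dual:
  fixes B :: "(real ^ 'd::finite) set"
  assumes B: "is_Z_basis B int_lattice" and b: "b \<in> B"
  shows "\<exists>\<phi>\<in>int_lattice. \<forall>b'\<in>B. \<phi> \<bullet> b' = of_bool (b' = b)"
proof -
  have fin: "finite B" and sub: "B \<subseteq> int_lattice" using B by (auto simp: is_Z_basis_def)
  have ex1: "\<exists>!c :: real ^ 'd \<Rightarrow> int. (\<forall>v. v \<notin> B \<longrightarrow> c v = 0) \<and> x = (\<Sum>v\<in>B. of_int (c v) *\<^sub>R v)"
    if "x \<in> int_lattice" for x
    using B that unfolding is_Z_basis_def by blast
  have "\<forall>k. \<exists>c :: real ^ 'd \<Rightarrow> int. (\<forall>v. v \<notin> B \<longrightarrow> c v = 0) \<and> axis k 1 = (\<Sum>v\<in>B. of_int (c v) *\<^sub>R v)"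
    using ex1[OF axis_int_lattice] by blast
  then obtain c :: "'d \<Rightarrow> real ^ 'd \<Rightarrow> int" where
    c0: "\<And>k v. v \<notin> B \<Longrightarrow> c k v = 0" and
    c: "\<And>k. axis k 1 = (\<Sum>v\<in>B. of_int (c k v) *\<^sub>R v)"
    by metis
  \<comment> \<open>Row \<open>b\<close> of the matrix expressing the unit vectors in the basis \<open>B\<close>.\<close>
  define \<phi> :: "real ^ 'd" where "\<phi> = (\<chi> k. of_int (c k b))"
  have "\<phi> \<bullet> b' = of_bool (b' = b)" if b': "b' \<in> B" for b'
  proof -
    have "\<forall>k. \<exists>n::int. b' $ k = of_int n"
      using b' sub by (auto simp: int_lattice_def elim!: Ints_cases)
    then obtain n :: "'d \<Rightarrow> int" where n: "\<And>k. b' $ k = of_int (n k)" by metis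
    define e where "e v = (\<Sum>k\<in>UNIV. n k * c k v)" for v
    have "b' = (\<Sum>k\<in>UNIV. (b' $ k) *\<^sub>R axis k 1)"
      by (simp add: basis_expansion flip: scalar_mult_eq_scaleR)
    also have "\<dots> = (\<Sum>k\<in>UNIV. \<Sum>v\<in>B. of_int (n k * c k v) *\<^sub>R v)"
      by (subst c) (simp add: n scaleR_sum_right)
    also have "\<dots> = (\<Sum>v\<in>B. of_int (e v) *\<^sub>R v)"
      by (subst sum.swap) (simp add: e_def scaleR_sum_left)
    finally have e: "b' = (\<Sum>v\<in>B. of_int (e v) *\<^sub>R v)" .
    define \<delta> :: "real ^ 'd \<Rightarrow> int" where "\<delta> v = of_bool (v = b')" for v
    have "(\<Sum>v\<in>B. of_int (\<delta> v) *\<^sub>R v) = (\<Sum>v\<in>{b'}. of_int (\<delta> v) *\<^sub>R v)"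
      using fin b' by (intro sum.mono_neutral_right) (auto simp: \<delta>_def)
    then have \<delta>: "b' = (\<Sum>v\<in>B. of_int (\<delta> v) *\<^sub>R v)" by (simp add: \<delta>_def)
    have uniq: "c = c'" if "\<forall>v. v \<notin> B \<longrightarrow> c v = 0" "b' = (\<Sum>v\<in>B. of_int (c v) *\<^sub>R v)"
      "\<forall>v. v \<notin> B \<longrightarrow> c' v = 0" "b' = (\<Sum>v\<in>B. of_int (c' v) *\<^sub>R v)" for c c' :: "real ^ 'd \<Rightarrow> int"
      using ex1[OF subsetD[OF sub b']] that by blast
    have "e = \<delta>"
    proof (rule uniq)
      show "\<forall>v. v \<notin> B \<longrightarrow> e v = 0" by (simp add: e_def c0)
      show "\<forall>v. v \<notin> B \<longrightarrow> \<delta> v = 0" using b' by (auto simp: \<delta>_def)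
    qed (rule e \<delta>)+
    then have "e b = of_bool (b' = b)" by (auto simp: \<delta>_def)
    moreover have "\<phi> \<bullet> b' = of_int (e b)"
      by (simp add: inner_vec_def \<phi>_def n e_def mult.commute)
    ultimately show ?thesis by simp
  qed
  moreover have "\<phi> \<in> int_lattice" by (simp add: \<phi>_def int_lattice_def)
  ultimately show ?thesis by blast
qed

lemma Z_basis_span:
  fixes B :: "(real ^ 'd::finite) set"
  assumes B: "is_Z_basis B int_lattice"
  shows "span B = UNIV"
proof -
  have "axis k 1 \<in> span B" for k
  proof -
    obtain c :: "real ^ 'd \<Rightarrow> int" where "axis k 1 = (\<Sum>v\<in>B. of_int (c v) *\<^sub>R v)"
      using B axis_int_lattice[of k] unfolding is_Z_basis_def by blast
    moreover have "(\<Sum>v\<in>B. of_int (c v) *\<^sub>R v) \<in> span B"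
      by (intro span_sum span_scale span_base)
    ultimately show ?thesis by simp
  qed
  then have "(\<Sum>k\<in>UNIV. (x $ k) *\<^sub>R axis k 1) \<in> span B" for x
    by (auto intro!: span_sum span_scale)
  moreover have "(\<Sum>k\<in>UNIV. (x $ k) *\<^sub>R axis k 1) = x" for x :: "real ^ 'd"
    by (simp add: basis_expansion flip: scalar_mult_eq_scaleR)
  ultimately show ?thesis by (metis UNIV_eq_I)
qed

lemma Z_basis_coordinates:
  fixes B :: "(real ^ 'd::finite) set"
  assumes B: "is_Z_basis B int_lattice"
  obtains g where "lattice_iso g" "g ` B = range (\<lambda>i. axis i 1)"
proof -
  have fin: "finite B" and sub: "B \<subseteq> int_lattice" using B by (auto simp: is_Z_basis_def)
  obtain \<phi> where \<phi>: "\<And>b. b \<in> B \<Longrightarrow> \<phi> b \<in> int_lattice"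
      "\<And>b b'. b \<in> B \<Longrightarrow> b' \<in> B \<Longrightarrow> \<phi> b \<bullet> b' = of_bool (b' = b)"
    using Z_basis_dual[OF B] by metis
  have "independent B"
  proof
    assume "dependent B"
    then obtain u v where uv: "v \<in> B" "u v \<noteq> 0" "(\<Sum>v\<in>B. u v *\<^sub>R v) = 0"
      using dependent_finite[OF fin] by blast
    have "0 = (\<Sum>w\<in>B. u w * (\<phi> v \<bullet> w))"
      using uv(3) by (metis (no_types, lifting) inner_scaleR_right inner_sum_right inner_zero_right sum.cong)
    also have "\<dots> = (\<Sum>w\<in>{v}. u w * (\<phi> v \<bullet> w))"
      using fin uv \<phi>(2) by (intro sum.mono_neutral_right) auto
    also have "\<dots> = u v" using \<phi>(2)[OF uv(1) uv(1)] by simp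
    finally show False using uv(2) by simp
  qed
  then have "card B = CARD('d)"
    using basis_card_eq_dim[of B UNIV] Z_basis_span[OF B] by simp
  then obtain \<beta> where \<beta>: "bij_betw \<beta> (UNIV :: 'd set) B"
    using finite_same_card_bij[of "UNIV :: 'd set" B] fin by auto
  have \<beta>B: "\<beta> i \<in> B" for i using \<beta> by (auto simp: bij_betw_def)
  have \<beta>eq: "\<beta> i = \<beta> j \<longleftrightarrow> i = j" for i j
    using \<beta> by (auto simp: bij_betw_def inj_eq)
  define g :: "real ^ 'd \<Rightarrow> real ^ 'd" where "g x = (\<chi> i. \<phi> (\<beta> i) \<bullet> x)" for x
  define g' :: "real ^ 'd \<Rightarrow> real ^ 'd" where "g' x = (\<Sum>i\<in>UNIV. (x $ i) *\<^sub>R \<beta> i)" for x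
  have lin: "linear g" "linear g'"
    by (auto intro!: linearI simp: g_def g'_def vec_eq_iff inner_add_right scaleR_add_left
        sum.distrib scaleR_sum_right)
  have gg': "g (g' x) = x" for x
  proof -
    have "g (g' x) $ i = (\<Sum>j\<in>UNIV. if j = i then x $ j else 0)" for i
      by (simp add: g_def g'_def inner_sum_right \<phi>(2)[OF \<beta>B \<beta>B] \<beta>eq of_bool_def if_distrib cong: if_cong)
    then show ?thesis by (simp add: vec_eq_iff)
  qed
  then have g'g: "g' (g x) = x" for x
    using linear_inverse_left[OF lin] by (metis comp_apply eq_id_iff)
  have bij: "bij g" by (rule bijI') (metis g'g, metis gg')
  have g_int: "g x \<in> int_lattice" if "x \<in> int_lattice" for x
    using inner_int_lattice[OF \<phi>(1)[OF \<beta>B] that] by (simp add: g_def int_lattice_def)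
  have g'_int: "g' x \<in> int_lattice" if "x \<in> int_lattice" for x
    using that sub \<beta>B by (auto simp: g'_def int_lattice_def intro!: Ints_sum Ints_mult)
  have "g ` int_lattice = int_lattice"
    using g_int g'_int gg' by (auto simp: image_iff) metis
  with lin bij have "lattice_iso g" by (simp add: lattice_iso_def)
  moreover have "g (\<beta> i) = axis i 1" for i
    by (simp add: g_def \<phi>(2)[OF \<beta>B \<beta>B] \<beta>eq axis_def of_bool_def eq_commute)
  then have "g ` B = range (\<lambda>i. axis i 1)"
    using \<beta> by (auto simp: bij_betw_def image_iff)
  ultimately show thesis by (rule that)
qed

lemma integral_dual_property_image:
  assumes V: "integral_dual_property V" and g: "lattice_iso g"
  shows "integral_dual_property (g ` V)"
proof -
  have lin: "linear g" and bij: "bij g" and gL: "g ` int_lattice = int_lattice"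
    using g by (auto simp: lattice_iso_def)
  obtain g' where g': "linear g'" "g' \<circ> g = id"
    using linear_injective_left_inverse[OF lin] bij by (auto simp: bij_def)
  have g'g: "g' (g x) = x" for x using g' by (metis comp_apply id_apply)
  have g'L: "g' x \<in> int_lattice" if "x \<in> int_lattice" for x
    using that gL g'g by (metis (no_types) imageE)
  show ?thesis
    unfolding integral_dual_property_def
  proof (intro allI impI)
    fix u x assume u: "\<forall>y\<in>g ` V. u \<bullet> y \<le> 1" and x: "x \<in> g ` V" "u \<bullet> x = 1"
    have adj: "adjoint g u \<bullet> y = u \<bullet> g y" for y
      using adjoint_works[OF lin, of y u] by (simp add: inner_commute)
    obtain z where z: "z \<in> V" "x = g z" using x by blast
    obtain \<phi> where \<phi>: "\<phi> \<in> int_lattice" "\<phi> \<bullet> z = 1"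
      "\<forall>y\<in>V. adjoint g u \<bullet> y = 1 \<longrightarrow> y \<noteq> z \<longrightarrow> \<phi> \<bullet> y = 0"
      using V u x z adj unfolding integral_dual_property_def by (metis image_eqI)
    define \<psi> where "\<psi> = adjoint g' \<phi>"
    have \<psi>: "\<psi> \<bullet> y = \<phi> \<bullet> g' y" for y
      using adjoint_works[OF g'(1), of y \<phi>] by (simp add: inner_commute \<psi>_def)
    have "\<psi> $ i \<in> \<int>" for i
      using inner_int_lattice[OF \<phi>(1) g'L[OF axis_int_lattice[of i]]] \<psi>[of "axis i 1"]
      by (simp add: inner_axis)
    then have "\<psi> \<in> int_lattice" by (simp add: int_lattice_def)
    then show "\<exists>\<phi>\<in>int_lattice. \<phi> \<bullet> x = 1 \<and> (\<forall>y\<in>g ` V. u \<bullet> y = 1 \<longrightarrow> y \<noteq> x \<longrightarrow> \<phi> \<bullet> y = 0)"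
      using \<phi> z by (intro bexI[of _ \<psi>]) (auto simp: \<psi> g'g adj)
  qed
qed

section \<open>Facets of smooth Fano polytopes\<close>

lemma fano_polytopeD:
  assumes "fano_polytope P"
  shows "polyhedron P" "convex P" "0 \<in> interior P" "P = convex hull (vertices P)"
    "finite (vertices P)" "vertices P \<subseteq> int_lattice" "vertices P \<subseteq> P"
proof -
  have P: "polytope P" using assms by (simp add: fano_polytope_def)
  show poly: "polyhedron P" using P by (rule polytope_imp_polyhedron)
  show conv: "convex P" using P by (rule polytope_imp_convex)
  show "0 \<in> interior P" "vertices P \<subseteq> int_lattice"
    using assms by (auto simp: fano_polytope_def)
  show "P = convex hull (vertices P)"
    unfolding vertices_def by (rule Krein_Milman_Minkowski[OF polytope_imp_compact[OF P] conv])
  show "finite (vertices P)"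
    unfolding vertices_def by (rule finite_polyhedron_extreme_points[OF poly])
  show "vertices P \<subseteq> P" by (auto simp: vertices_def extreme_point_of_def)
qed

lemma vertices_facet:
  assumes "F facet_of P"
  shows "vertices F = vertices P \<inter> F"
  using extreme_point_of_face[OF facet_of_imp_face_of[OF assms]] by (auto simp: vertices_def)

lemma vertices_uminus: "vertices (uminus ` F) = uminus ` vertices F"
proof -
  have "- v extreme_point_of uminus ` F \<longleftrightarrow> v extreme_point_of F" for v
    using face_of_linear_image[of uminus "{v}" F] by (simp add: face_of_singleton linear_uminus inj_def)
  then show ?thesis unfolding vertices_def by (auto simp: image_iff) (metis minus_minus)+
qed

lemma facet_functional:
  assumes P: "fano_polytope P" and F: "F facet_of P"
  obtains u where "\<And>x. x \<in> P \<Longrightarrow> u \<bullet> x \<le> 1" "vertices F = {x \<in> vertices P. u \<bullet> x = 1}"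
proof -
  obtain a b where a: "a \<noteq> 0" "P \<subseteq> {x. a \<bullet> x \<le> b}" "F = P \<inter> {x. a \<bullet> x = b}"
    using facet_of_polyhedron[OF fano_polytopeD(1)[OF P] F] by metis
  have "0 \<in> interior {x. a \<bullet> x \<le> b}"
    using fano_polytopeD(3)[OF P] interior_mono[OF a(2)] by blast
  then have b: "b > 0" using a(1) by simp
  define u where "u = a /\<^sub>R b"
  have u: "u \<bullet> x = a \<bullet> x / b" for x by (simp add: u_def divide_inverse mult.commute)
  show thesis
  proof (rule that[of u])
    show "u \<bullet> x \<le> 1" if "x \<in> P" for x using a(2) that b by (auto simp: u)
    show "vertices F = {x \<in> vertices P. u \<bullet> x = 1}"
      unfolding vertices_facet[OF F] using fano_polytopeD(7)[OF P] b by (auto simp: a(3) u)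
  qed
qed

text \<open>
  The vertices on a supporting hyperplane that avoids the origin span a proper face, which lies in a
  facet; the vertices of that facet form a \<open>\<int>\<close>-basis.
\<close>

lemma smooth_fano_integral_dual:
  assumes "smooth_fano_polytope P"
  shows "integral_dual_property (vertices P)"
  unfolding integral_dual_property_def
proof (intro allI impI)
  fix u x assume le: "\<forall>y\<in>vertices P. u \<bullet> y \<le> 1" and x: "x \<in> vertices P" "u \<bullet> x = 1"
  have P: "fano_polytope P" using assms by (simp add: smooth_fano_polytope_def)
  note Pf = fano_polytopeD[OF P]
  have "convex hull (vertices P) \<subseteq> {y. u \<bullet> y \<le> 1}"
    using le by (intro hull_minimal convex_halfspace_le) auto
  then have leP: "u \<bullet> y \<le> 1" if "y \<in> P" for y using that Pf(4) by auto
  define T where "T = P \<inter> {y. u \<bullet> y = 1}"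
  have "T face_of P" unfolding T_def by (rule face_of_Int_supporting_hyperplane_le[OF Pf(2) leP])
  moreover have "T \<noteq> {}" using x Pf(7) by (auto simp: T_def)
  moreover have "T \<noteq> P"
  proof
    assume "T = P"
    moreover have "0 \<in> P" using Pf(3) interior_subset by blast
    ultimately have "0 \<in> T" by simp
    then show False by (simp add: T_def)
  qed
  ultimately obtain F where F: "F facet_of P" "T \<subseteq> F"
    using face_of_polyhedron_subset_facet[OF Pf(1)] by metis
  have B: "is_Z_basis (vertices F) int_lattice"
    using assms F(1) by (simp add: smooth_fano_polytope_def)
  have tight: "y \<in> vertices F" if "y \<in> vertices P" "u \<bullet> y = 1" for y
    using that F Pf(7) by (auto simp: vertices_facet[OF F(1)] T_def)
  obtain \<phi> where "\<phi> \<in> int_lattice" "\<forall>y\<in>vertices F. \<phi> \<bullet> y = of_bool (y = x)"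
    using Z_basis_dual[OF B tight[OF x]] by blast
  then show "\<exists>\<phi>\<in>int_lattice. \<phi> \<bullet> x = 1 \<and> (\<forall>y\<in>vertices P. u \<bullet> y = 1 \<longrightarrow> y \<noteq> x \<longrightarrow> \<phi> \<bullet> y = 0)"
    using tight x by (intro bexI[of _ \<phi>]) auto
qed

text \<open>
  The functionals of \<open>F\<close> and \<open>- F\<close> are opposite because they are so on the vertices of \<open>F\<close>,
  which span the space; in the coordinates \<open>g\<close> given by these vertices the former is the coordinate
  sum.
\<close>

lemma pseudo_symmetric_opposite_facets:
  fixes P :: "(real ^ 'd::finite) set"
  assumes smooth: "smooth_fano_polytope P" and ps: "pseudo_symmetric P"
  obtains g where "lattice_iso g" "opposite_facets (g ` vertices P)"
proof -
  have P: "fano_polytope P" using smooth by (simp add: smooth_fano_polytope_def)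
  note Pf = fano_polytopeD[OF P]
  obtain F where F: "F facet_of P" and nF: "(uminus ` F) facet_of P"
    using ps by (auto simp: pseudo_symmetric_def)
  define B where "B = vertices F"
  have B: "is_Z_basis B int_lattice"
    using smooth F by (simp add: smooth_fano_polytope_def B_def)
  obtain g where g: "lattice_iso g" "g ` B = range (\<lambda>i. axis i 1)"
    using Z_basis_coordinates[OF B] by blast
  then have lin: "linear g" and inj: "inj g" and gL: "g ` int_lattice = int_lattice"
    by (auto simp: lattice_iso_def bij_def)
  obtain u where u: "\<And>x. x \<in> P \<Longrightarrow> u \<bullet> x \<le> 1" "B = {x \<in> vertices P. u \<bullet> x = 1}"
    using facet_functional[OF P F] unfolding B_def by metis
  obtain u' where u': "\<And>x. x \<in> P \<Longrightarrow> u' \<bullet> x \<le> 1" "uminus ` B = {x \<in> vertices P. u' \<bullet> x = 1}"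
    using facet_functional[OF P nF] unfolding B_def vertices_uminus by metis
  have lin_inner: "linear (\<lambda>x. c \<bullet> x)" for c :: "real ^ 'd"
    by (rule bounded_linear.linear[OF bounded_linear_inner_right])
  have on_B: "f x = h x" if "linear f" "linear h" "\<And>b. b \<in> B \<Longrightarrow> f b = h b"
    for f h :: "real ^ 'd \<Rightarrow> real" and x
    by (rule linear_eq_on[OF that(1,2) _ that(3)]) (simp_all add: Z_basis_span[OF B])
  have "u' \<bullet> x = (- u) \<bullet> x" for x
  proof (rule on_B[OF lin_inner lin_inner])
    fix b assume b: "b \<in> B"
    then have "- b \<in> uminus ` B" by blast
    then show "u' \<bullet> b = (- u) \<bullet> b" using u'(2) b u(2) by auto
  qed
  then have u'u: "u' \<bullet> x = - (u \<bullet> x)" for x by simp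
  have "linear (coord_sum \<circ> g)"
    unfolding comp_def coord_sum_inner by (rule linear_compose[OF lin lin_inner, unfolded comp_def])
  moreover have "(coord_sum \<circ> g) b = u \<bullet> b" if "b \<in> B" for b
  proof -
    have "g b \<in> range (\<lambda>i. axis i 1)" using g(2) that by blast
    then show ?thesis using that u(2) by auto
  qed
  ultimately have sum_g: "coord_sum (g x) = u \<bullet> x" for x
    using on_B[OF _ lin_inner, of "coord_sum \<circ> g" u x] by simp
  have axis_B: "\<exists>b\<in>B. axis i 1 = g b" for i
    using g(2) by (metis imageE rangeI)
  have BV: "b \<in> vertices P" "- b \<in> vertices P" if "b \<in> B" for b
    using that u(2) u'(2) by auto
  have "opposite_facets (g ` vertices P)"
  proof
    show "finite (g ` vertices P)" using Pf(5) by simp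
    show "g ` vertices P \<subseteq> int_lattice" using Pf(6) gL by blast
    have "0 \<notin> vertices P"
      using Pf(3) extreme_point_not_in_interior by (auto simp: vertices_def)
    then show "0 \<notin> g ` vertices P" using lin inj linear_injective_0 by (metis imageE)
    show "axis i 1 \<in> g ` vertices P" for i using axis_B[of i] BV by auto
    show "- axis i 1 \<in> g ` vertices P" for i
      using axis_B[of i] BV linear_neg[OF lin] by (metis image_eqI)
    show "coord_sum x \<le> 1" if "x \<in> g ` vertices P" for x using that sum_g u(1) Pf(7) by auto
    show "- 1 \<le> coord_sum x" if "x \<in> g ` vertices P" for x
      using that sum_g u'(1) u'u Pf(7) by (smt (verit) imageE subsetD)
    show "x \<in> range (\<lambda>i. axis i 1)" if "x \<in> g ` vertices P" "coord_sum x = 1" for x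
      using that sum_g u(2) g(2) by auto
    show "x \<in> range (\<lambda>i. - axis i 1)" if x: "x \<in> g ` vertices P" "coord_sum x = - 1" for x
    proof -
      obtain v where v: "v \<in> vertices P" "x = g v" using x by blast
      then have "v \<in> uminus ` B" using x sum_g u'u u'(2) by auto
      then have "- x \<in> g ` B" using v linear_neg[OF lin] by auto
      then obtain i where "- x = axis i 1" using g(2) by auto
      then have "x = - axis i 1" by (metis minus_minus)
      then show ?thesis by blast
    qed
    show "integral_dual_property (g ` vertices P)"
      by (rule integral_dual_property_image[OF smooth_fano_integral_dual[OF smooth] g(1)])
  qed
  with g(1) show thesis by (rule that)
qed

lemma lattice_iso_flip_signs:
  assumes s: "\<And>i. s i = 1 \<or> s i = -1"
  shows "lattice_iso (flip_signs s)"
proof -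
  have ss: "s i * (s i * y) = y" for i y using s[of i] by auto
  have inv: "flip_signs s (flip_signs s x) = x" for x by (simp add: flip_signs_def ss)
  have int: "flip_signs s x \<in> int_lattice" if "x \<in> int_lattice" for x
    using that s by (auto simp: int_lattice_def flip_signs_def) (metis Ints_minus mult_1 mult_minus1)
  have "linear (flip_signs s)"
    by (intro linearI) (auto simp: flip_signs_def vec_eq_iff algebra_simps)
  moreover have "bij (flip_signs s)" by (rule bijI') (metis inv, metis inv)
  moreover have "flip_signs s ` int_lattice = int_lattice"
    using int inv by (auto simp: image_iff) metis
  ultimately show ?thesis by (simp add: lattice_iso_def)
qed

lemma lattice_iso_compose: "lattice_iso f \<Longrightarrow> lattice_iso g \<Longrightarrow> lattice_iso (f \<circ> g)"
  unfolding lattice_iso_def by (metis linear_compose bij_comp image_comp)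

theorem pseudo_symmetric_classification:
  assumes "smooth_fano_polytope P" and "pseudo_symmetric P"
  obtains g C C' where "lattice_iso g" "even_blocks C C'" "g ` vertices P = block_vertices C C'"
proof -
  obtain g where g: "lattice_iso g" "opposite_facets (g ` vertices P)"
    using pseudo_symmetric_opposite_facets[OF assms] by blast
  obtain s C C' where s: "\<And>i. s i = 1 \<or> s i = -1" "even_blocks C C'"
    "flip_signs s ` g ` vertices P = block_vertices C C'"
    using opposite_facets.sign_normal_form[OF g(2)] by metis
  have "lattice_iso (flip_signs s \<circ> g)"
    by (rule lattice_iso_compose[OF lattice_iso_flip_signs[OF s(1)] g(1)])
  moreover have "(flip_signs s \<circ> g) ` vertices P = block_vertices C C'"
    using s(3) by (simp only: image_comp)
  ultimately show thesis using s(2) that by blast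
qed

text \<open>
  Any facet will do; one exists because a vertex is a proper face.
\<close>

lemma centrally_symmetric_imp_pseudo_symmetric:
  fixes P :: "(real ^ 'd::finite) set"
  assumes P: "fano_polytope P" and sym: "centrally_symmetric P"
  shows "pseudo_symmetric P"
proof -
  note Pf = fano_polytopeD[OF P]
  have "vertices P \<noteq> {}" using Pf(3,4) interior_subset[of P] by (metis convex_hull_empty empty_iff subsetD)
  then obtain v where v: "v extreme_point_of P" by (auto simp: vertices_def)
  then have "{v} face_of P" by (simp add: face_of_singleton)
  moreover have "{v} \<noteq> P"
    using v extreme_point_not_in_interior Pf(3) interior_subset[of P] by (metis singletonD subsetD)
  ultimately obtain F where F: "F facet_of P"
    using face_of_polyhedron_subset_facet[OF Pf(1)] by (metis insert_not_empty)
  have "aff_dim (uminus ` S) = aff_dim S" for S :: "(real ^ 'd) set"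
    by (rule aff_dim_injective_linear_image) (auto simp: linear_uminus inj_def)
  moreover have "(uminus ` F) face_of (uminus ` P)"
    using F by (subst face_of_linear_image) (auto simp: linear_uminus inj_def facet_of_imp_face_of)
  ultimately have "(uminus ` F) facet_of (uminus ` P)"
    using F by (auto simp: facet_of_def)
  then show ?thesis using F sym unfolding pseudo_symmetric_def centrally_symmetric_def by metis
qed

section \<open>Cycles in a path with chords\<close>

text \<open>
  Adjacency in the path on the natural numbers with a chord from \<open>a\<close> to \<open>b\<close> for each \<open>(a, b) \<in> Q\<close>.
\<close>

definition chord_path_adj :: "(nat \<times> nat) set \<Rightarrow> nat \<Rightarrow> nat \<Rightarrow> bool" where
  "chord_path_adj Q x y \<longleftrightarrow> y = Suc x \<or> x = Suc y \<or> (x, y) \<in> Q \<or> (y, x) \<in> Q"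

definition nonoverlapping :: "(nat \<times> nat) set \<Rightarrow> bool" where
  "nonoverlapping Q \<longleftrightarrow> (\<forall>(a, b)\<in>Q. a < b) \<and>
     (\<forall>(a, b)\<in>Q. \<forall>(a', b')\<in>Q. (a, b) = (a', b') \<or> b \<le> a' \<or> b' \<le> a)"

text \<open>
  A cycle is represented by a sequence on the integers with period \<open>L\<close>, so that both the choice of a
  base point and the direction of traversal can be changed by substitution.  Strictly inside the
  interval of the chord \<open>(a, b)\<close> no other chord starts or ends, so a cycle that enters it from \<open>a\<close> is
  forced to walk up to \<open>b\<close>.  There it is at the position preceding \<open>a\<close>, after \<open>b - a + 1\<close> steps.
\<close>

lemma closed_walk_around_chord:
  fixes t :: "int \<Rightarrow> nat"
  assumes L: "L \<ge> 3" and cyc: "\<And>j k. t j = t k \<longleftrightarrow> int L dvd j - k"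
    and adj: "\<And>k. chord_path_adj Q (t k) (t (k + 1))"
    and Q: "nonoverlapping Q" "(a, b) \<in> Q"
    and start: "t 0 = a" "t 1 = Suc a" "t (- 1) = b"
  shows "L dvd Suc (b - a)"
proof -
  have ab: "a < b" using Q by (auto simp: nonoverlapping_def)
  have Qd: "a' < b'" "(a = a' \<and> b = b') \<or> b \<le> a' \<or> b' \<le> a" if "(a', b') \<in> Q" for a' b'
    using Q that unfolding nonoverlapping_def by auto
  have step: "\<forall>j\<le>k. t (int j) = a + j" if "1 \<le> k" "k \<le> b - a" for k
    using that
  proof (induction k rule: dec_induct)
    case base
    show ?case
    proof (intro allI impI)
      fix j :: nat assume "j \<le> 1"
      then consider "j = 0" | "j = 1" by linarith
      then show "t (int j) = a + j" by cases (simp_all add: start)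
    qed
  next
    case (step k)
    then have IH: "\<forall>j\<le>k. t (int j) = a + j" by simp
    have tk: "t (int k) = a + k" and tk1: "t (int k - 1) = a + k - 1"
      using IH[rule_format, of k] IH[rule_format, of "k - 1"] step.hyps by (auto simp: of_nat_diff)
    have "t (int k + 1) \<noteq> t (int k - 1)"
      using L by (auto simp: cyc dest: zdvd_imp_le)
    moreover have "(a + k, y) \<notin> Q" "(y, a + k) \<notin> Q" for y
      using Qd[of "a + k" y] Qd[of y "a + k"] step.hyps step.prems by auto
    then have "t (int k + 1) = Suc (a + k) \<or> a + k = Suc (t (int k + 1))"
      using adj[of "int k"] unfolding chord_path_adj_def tk by blast
    ultimately have "t (int (Suc k)) = a + Suc k"
      using tk1 step.hyps by (auto simp: add.commute)
    then show ?case using IH by (auto simp: le_Suc_eq)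
  qed
  have "t (int (b - a)) = a + (b - a)"
    by (rule step[of "b - a", rule_format]) (use ab in auto)
  then have "t (int (b - a)) = b" using ab by linarith
  then have "int L dvd int (b - a) - (- 1)" using start by (metis cyc)
  then have "int L dvd int (Suc (b - a))" by (simp add: add.commute)
  then show ?thesis by (simp only: int_dvd_int_iff)
qed

text \<open>
  At its least node \<open>a\<close> a cycle uses two different edges going up.  One is the path edge, and the
  other is the only chord starting at \<open>a\<close>.
\<close>

lemma chord_path_cycle_odd:
  fixes s :: "int \<Rightarrow> nat"
  assumes L: "L \<ge> 3" and cyc: "\<And>j k. s j = s k \<longleftrightarrow> int L dvd j - k"
    and adj: "\<And>k. chord_path_adj Q (s k) (s (k + 1))"
    and Q: "nonoverlapping Q" and even: "\<And>a b. (a, b) \<in> Q \<Longrightarrow> even (b - a)"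
  shows "odd L"
proof -
  define a where "a = (LEAST x. x \<in> range s)"
  have "a \<in> range s" unfolding a_def by (rule LeastI[of _ "s 0"]) simp
  then obtain m where m: "s m = a" by auto
  have min: "a \<le> s k" for k unfolding a_def by (rule Least_le) simp
  have adj_sym: "chord_path_adj Q x y \<longleftrightarrow> chord_path_adj Q y x" for x y
    by (auto simp: chord_path_adj_def)
  have no1: "\<not> int L dvd 1" "\<not> int L dvd - 1" "\<not> int L dvd 2"
    using L by (auto dest: zdvd_imp_le)
  have ne: "s (m + 1) \<noteq> a" "s (m - 1) \<noteq> a" "s (m + 1) \<noteq> s (m - 1)"
    using no1 m[symmetric] by (auto simp: cyc)
  have up: "y = Suc a \<or> (a, y) \<in> Q" if "chord_path_adj Q a y" "a < y" for y
    using that Q by (auto simp: chord_path_adj_def nonoverlapping_def)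
  have gt: "a < s (m + 1)" "a < s (m - 1)" using ne min by (metis le_neq_implies_less)+
  have "s (m + 1) = Suc a \<or> (a, s (m + 1)) \<in> Q"
    using up[OF _ gt(1)] adj[of m] m by simp
  moreover have "s (m - 1) = Suc a \<or> (a, s (m - 1)) \<in> Q"
    using up[OF _ gt(2)] adj[of "m - 1"] m adj_sym by simp
  moreover have "b = b'" if "(a, b) \<in> Q" "(a, b') \<in> Q" for b b'
    using that Q by (force simp: nonoverlapping_def)
  ultimately consider "s (m + 1) = Suc a" "(a, s (m - 1)) \<in> Q"
    | "s (m - 1) = Suc a" "(a, s (m + 1)) \<in> Q" using ne(3) by metis
  then obtain b where b: "(a, b) \<in> Q" "L dvd Suc (b - a)"
  proof cases
    case 1
    have "L dvd Suc (s (m - 1) - a)"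
    proof (rule closed_walk_around_chord[OF L _ _ Q 1(2), of "\<lambda>k. s (m + k)"])
      show "chord_path_adj Q (s (m + k)) (s (m + (k + 1)))" for k
        using adj[of "m + k"] by (simp add: add.assoc)
    qed (use 1 m cyc in auto)
    then show ?thesis using 1 that by blast
  next
    case 2
    have "L dvd Suc (s (m + 1) - a)"
    proof (rule closed_walk_around_chord[OF L _ _ Q 2(2), of "\<lambda>k. s (m - k)"])
      show "chord_path_adj Q (s (m - k)) (s (m - (k + 1)))" for k
        using adj[of "m - k - 1"] adj_sym by (simp add: algebra_simps)
      show "s (m - j) = s (m - k) \<longleftrightarrow> int L dvd j - k" for j k
        using dvd_minus_iff[of "int L" "j - k"] by (simp add: cyc)
    qed (use 2 m in auto)
    then show ?thesis using 2 that by blast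
  qed
  then show ?thesis using even[OF b(1)] by (metis dvd_trans even_Suc)
qed

text \<open>
  A cycle is an arc list; the sequence repeats the heads of its arcs, which are distinct.
\<close>

lemma cycle_as_periodic_sequence:
  fixes H :: "'v pair_pre_digraph"
  assumes "pre_digraph.cycle (with_proj H) p"
  obtains s :: "int \<Rightarrow> 'v" where "\<And>j k. s j = s k \<longleftrightarrow> int (length p) dvd j - k"
    "\<And>k. (s k, s (k + 1)) \<in> parcs H"
proof -
  obtain u where u: "pre_digraph.awalk (with_proj H) u p u" and ne: "p \<noteq> []"
    and dist: "distinct (tl (pre_digraph.awalk_verts (with_proj H) u p))"
    using assms unfolding pre_digraph.cycle_def by blast
  have cas: "pre_digraph.cas (with_proj H) u p u" and arcs: "set p \<subseteq> parcs H"
    using u by (auto simp: pre_digraph.awalk_def)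
  have verts: "pre_digraph.awalk_verts (with_proj H) x q = x # map snd q"
    if "pre_digraph.cas (with_proj H) x q y" for x y q
    using that by (induction q arbitrary: x)
      (auto simp: pre_digraph.awalk_verts.simps pre_digraph.cas.simps)
  have last_cas: "snd (last q) = y" if "pre_digraph.cas (with_proj H) x q y" "q \<noteq> []" for x y q
    using that by (induction q arbitrary: x) (auto simp: pre_digraph.cas.simps)
  have chain: "fst (q ! i) = (if i = 0 then x else snd (q ! (i - 1)))"
    if "pre_digraph.cas (with_proj H) x q y" "i < length q" for x y q i
    using that
  proof (induction q arbitrary: x i)
    case (Cons e q)
    then show ?case by (cases i) (auto simp: pre_digraph.cas.simps nth_Cons split: nat.splits)
  qed simp
  define L where "L = length p"
  have L0: "L > 0" using ne by (simp add: L_def)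
  define idx where "idx k = nat (k mod int L)" for k
  have idx: "idx k < L" for k using L0 by (simp add: idx_def nat_less_iff)
  define s where "s k = snd (p ! idx k)" for k
  have "distinct (map snd p)" using dist verts[OF cas] by simp
  then have "s j = s k \<longleftrightarrow> idx j = idx k" for j k
    using idx unfolding s_def L_def by (metis length_map nth_eq_iff_index_eq nth_map)
  also have "idx j = idx k \<longleftrightarrow> int L dvd j - k" for j k
    using L0 unfolding mod_eq_dvd_iff[symmetric] by (simp add: idx_def eq_nat_nat_iff)
  finally have per: "s j = s k \<longleftrightarrow> int (length p) dvd j - k" for j k by (simp add: L_def)
  have "(s k, s (k + 1)) \<in> parcs H" for k
  proof -
    have "fst (p ! idx (k + 1)) = s k"
    proof (cases "idx (k + 1) = 0")
      case True
      then have "(k + 1) mod int L \<le> 0" by (simp add: idx_def)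
      moreover have "0 \<le> (k + 1) mod int L" using L0 by simp
      ultimately have "(k + 1) mod int L = 0" by (rule antisym)
      then have "int L dvd k + 1" by (simp add: dvd_eq_mod_eq_0)
      then have "int L dvd k - (int L - 1)"
        using dvd_diff[of "int L" "k + 1" "int L"] by (simp add: algebra_simps)
      then have "k mod int L = (int L - 1) mod int L" by (simp only: mod_eq_dvd_iff)
      also have "(int L - 1) mod int L = int L - 1"
        by (rule mod_pos_pos_trivial) (use L0 in auto)
      finally have "k mod int L = int L - 1" .
      then have "idx k = L - 1" by (simp add: idx_def)
      then have "s k = snd (last p)" using ne by (simp add: s_def last_conv_nth L_def)
      then show ?thesis using chain[OF cas, of "idx (k + 1)"] idx True last_cas[OF cas ne] L0
        by (simp add: L_def)
    next
      case False
      have "(k + 1) mod int L = k mod int L + 1"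
      proof -
        have r: "0 \<le> k mod int L" "k mod int L < int L" using L0 by simp_all
        have e: "(k + 1) mod int L = (k mod int L + 1) mod int L" by (simp add: mod_add_left_eq)
        have "k mod int L + 1 \<noteq> int L" using False unfolding idx_def e by auto
        then show ?thesis unfolding e using r by (intro mod_pos_pos_trivial) auto
      qed
      then have "idx (k + 1) - 1 = idx k"
        using L0 by (simp add: idx_def nat_add_distrib)
      then show ?thesis using chain[OF cas, of "idx (k + 1)"] idx False by (simp add: s_def L_def)
    qed
    moreover have "p ! idx (k + 1) \<in> parcs H" using arcs idx by (auto simp: L_def)
    ultimately show ?thesis by (metis s_def prod.collapse)
  qed
  with per show thesis by (rule that)
qed

section \<open>Coordinates as edges of a Hamiltonian path\<close>

text \<open>
  On the hyperplane of zero sum this is the inverse of \<open>path_edges\<close> below, and it preserves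
  integrality; thus the edges of the path form a \<open>\<int>\<close>-basis of the integer points of the hyperplane.
\<close>

definition prefix_sums :: "('d \<Rightarrow> nat) \<Rightarrow> (nat \<Rightarrow> 'n) \<Rightarrow> real ^ 'n::finite \<Rightarrow> real ^ 'd::finite" where
  "prefix_sums p \<nu> z = (\<chi> i. \<Sum>k\<le>p i. z $ \<nu> k)"

definition path_edges :: "('d \<Rightarrow> nat) \<Rightarrow> (nat \<Rightarrow> 'n) \<Rightarrow> real ^ 'd::finite \<Rightarrow> real ^ 'n::finite" where
  "path_edges p \<nu> x = (\<Sum>i\<in>UNIV. (x $ i) *\<^sub>R (axis (\<nu> (p i)) 1 - axis (\<nu> (Suc (p i))) 1))"

locale path_layout =
  fixes p :: "'d::finite \<Rightarrow> nat" and \<nu> :: "nat \<Rightarrow> 'n::finite" and d :: nat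
  assumes p: "bij_betw p UNIV {..<d}" and \<nu>: "bij_betw \<nu> {..d} UNIV"
begin

lemma p_less: "p i < d"
  using p by (auto simp: bij_betw_def)

lemma p_eq_iff: "p i = p j \<longleftrightarrow> i = j"
  using p by (auto simp: bij_betw_def inj_eq)

lemma \<nu>_eq_iff: "a \<le> d \<Longrightarrow> b \<le> d \<Longrightarrow> \<nu> a = \<nu> b \<longleftrightarrow> a = b"
  using \<nu> by (auto simp: bij_betw_def inj_on_eq_iff)

lemma linear_prefix_sums: "linear (prefix_sums p \<nu> :: real ^ 'n \<Rightarrow> real ^ 'd)"
  by (intro linearI) (auto simp: prefix_sums_def vec_eq_iff sum.distrib sum_distrib_left)

lemma linear_path_edges: "linear (path_edges p \<nu> :: real ^ 'd \<Rightarrow> real ^ 'n)"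
  by (intro linearI) (auto simp: path_edges_def scaleR_add_left sum.distrib scaleR_sum_right)

lemma prefix_sums_difference:
  assumes "a \<le> d" "b \<le> d"
  shows "prefix_sums p \<nu> (axis (\<nu> a) 1 - axis (\<nu> b) 1)
    = (\<chi> i. (of_bool (a \<le> p i) - of_bool (b \<le> p i) :: real))"
proof -
  have one: "(\<Sum>k\<le>p i. axis (\<nu> a) 1 $ \<nu> k) = (of_bool (a \<le> p i) :: real)" if "a \<le> d" for a i
  proof -
    have "(\<Sum>k\<le>p i. axis (\<nu> a) 1 $ \<nu> k) = (\<Sum>k\<le>p i. if k = a then 1 else (0::real))"
      using that p_less[of i] \<nu>_eq_iff by (intro sum.cong) (auto simp: axis_def)
    then show ?thesis by (simp add: sum.delta)
  qed
  show ?thesis by (simp add: prefix_sums_def vec_eq_iff sum_subtractf one assms)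
qed

lemma prefix_sums_path_edges: "prefix_sums p \<nu> (path_edges p \<nu> x) = x"
proof -
  have "prefix_sums p \<nu> (axis (\<nu> (p i)) 1 - axis (\<nu> (Suc (p i))) 1) = axis i 1" for i
  proof -
    have "of_bool (p i \<le> p j) - of_bool (Suc (p i) \<le> p j) = (of_bool (j = i) :: real)" for j
      using p_eq_iff[of i j] by (cases "p i \<le> p j \<and> p j \<le> p i") auto
    then show ?thesis
      using p_less[of i] by (simp add: prefix_sums_difference) (simp add: axis_def of_bool_def)
  qed
  then have "prefix_sums p \<nu> (path_edges p \<nu> x) = (\<Sum>i\<in>UNIV. (x $ i) *\<^sub>R axis i 1)"
    by (simp add: path_edges_def linear_sum[OF linear_prefix_sums] linear_scale[OF linear_prefix_sums]
        cong: sum.cong)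
  then show ?thesis by (simp add: basis_expansion flip: scalar_mult_eq_scaleR)
qed

lemma prefix_sums_inj_hyperplane:
  assumes z: "z \<in> zero_sum_hyperplane" and z0: "prefix_sums p \<nu> z = 0"
  shows "z = 0"
proof -
  have lt: "(\<Sum>k\<le>l. z $ \<nu> k) = 0" if "l < d" for l
  proof -
    have "l \<in> range p" using p that by (simp add: bij_betw_def)
    then obtain i where "p i = l" by auto
    then show ?thesis using z0 by (auto simp: prefix_sums_def vec_eq_iff)
  qed
  have "(\<Sum>k\<le>d. z $ \<nu> k) = (\<Sum>m\<in>UNIV. z $ m)"
    by (rule sum.reindex_bij_betw[OF \<nu>])
  then have all: "(\<Sum>k\<le>l. z $ \<nu> k) = 0" if "l \<le> d" for l
    using lt z that by (cases "l = d") (auto simp: zero_sum_hyperplane_def)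
  have "z $ \<nu> l = 0" if "l \<le> d" for l
  proof (cases l)
    case 0 then show ?thesis using all[of 0] by simp
  next
    case (Suc l') then show ?thesis using all[of l'] all[of l] that by simp
  qed
  moreover have "\<exists>l\<le>d. m = \<nu> l" for m
    using \<nu> by (auto simp: bij_betw_def image_iff)
  ultimately have "z $ m = 0" for m by metis
  then show ?thesis by (simp add: vec_eq_iff)
qed

lemma axis_difference_zero_sum: "axis a 1 - axis b 1 \<in> (zero_sum_hyperplane :: (real ^ 'n) set)"
  by (simp add: zero_sum_hyperplane_def sum_subtractf axis_def)

lemma path_edges_zero_sum: "path_edges p \<nu> x \<in> zero_sum_hyperplane"
proof -
  have sub: "subspace (zero_sum_hyperplane :: (real ^ 'n) set)"
    by (auto simp: subspace_def zero_sum_hyperplane_def sum.distrib simp flip: sum_distrib_left)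
  show ?thesis unfolding path_edges_def
    by (intro subspace_sum[OF sub] subspace_scale[OF sub] axis_difference_zero_sum)
qed

lemma path_edges_prefix_sums:
  assumes z: "z \<in> zero_sum_hyperplane"
  shows "path_edges p \<nu> (prefix_sums p \<nu> z) = z"
proof -
  define w where "w = path_edges p \<nu> (prefix_sums p \<nu> z) - z"
  have "w \<in> zero_sum_hyperplane"
    using path_edges_zero_sum[of "prefix_sums p \<nu> z"] z by (auto simp: w_def zero_sum_hyperplane_def sum_subtractf)
  moreover have "prefix_sums p \<nu> w = 0"
    by (simp add: w_def linear_diff[OF linear_prefix_sums] prefix_sums_path_edges)
  ultimately have "w = 0" by (rule prefix_sums_inj_hyperplane)
  then show ?thesis by (simp add: w_def)
qed

lemma path_edges_int: "x \<in> int_lattice \<Longrightarrow> path_edges p \<nu> x \<in> int_lattice"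
  by (auto simp: path_edges_def int_lattice_def axis_def intro!: Ints_sum Ints_mult Ints_diff)

lemma prefix_sums_int: "z \<in> int_lattice \<Longrightarrow> prefix_sums p \<nu> z \<in> int_lattice"
  by (auto simp: prefix_sums_def int_lattice_def intro!: Ints_sum)

lemma path_edges_bij: "bij_betw (path_edges p \<nu>) UNIV zero_sum_hyperplane"
  by (rule bij_betwI[of _ _ _ "prefix_sums p \<nu>"])
    (auto simp: path_edges_zero_sum prefix_sums_path_edges path_edges_prefix_sums)

lemma path_edges_lattice: "path_edges p \<nu> ` int_lattice = zero_sum_hyperplane \<inter> int_lattice"
proof
  show "path_edges p \<nu> ` int_lattice \<subseteq> zero_sum_hyperplane \<inter> int_lattice"
    using path_edges_int path_edges_zero_sum by auto
  show "zero_sum_hyperplane \<inter> int_lattice \<subseteq> path_edges p \<nu> ` int_lattice"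
    using path_edges_prefix_sums prefix_sums_int by (metis IntE image_eqI subsetI)
qed

lemma path_edges_axis: "path_edges p \<nu> (axis i 1) = axis (\<nu> (p i)) 1 - axis (\<nu> (Suc (p i))) 1"
proof -
  have "path_edges p \<nu> (axis i 1) = (\<Sum>j\<in>UNIV. if j = i then axis (\<nu> (p j)) 1 - axis (\<nu> (Suc (p j))) 1 else 0)"
    unfolding path_edges_def by (intro sum.cong) (auto simp: axis_def)
  then show ?thesis by simp
qed

text \<open>
  The edges of a subpath add up to the difference of its ends; this is read off from the inverse map.
\<close>

lemma path_edges_interval:
  assumes X: "p ` X = {a..<b}" and "a \<le> b" "b \<le> d"
  shows "path_edges p \<nu> (ind_vec X) = axis (\<nu> a) 1 - axis (\<nu> b) 1"
proof -
  have "i \<in> X \<longleftrightarrow> a \<le> p i \<and> p i < b" for i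
    using X p_eq_iff by (metis (no_types, lifting) atLeastLessThan_iff image_iff)
  then have "ind_vec X = prefix_sums p \<nu> (axis (\<nu> a) 1 - axis (\<nu> b) 1)"
    using assms by (subst prefix_sums_difference) (auto simp: ind_vec_def vec_eq_iff)
  then show ?thesis by (simp add: path_edges_prefix_sums axis_difference_zero_sum)
qed

end

section \<open>The graph of a block configuration\<close>

lemma interval_layout:
  assumes "finite C" "disjoint C" "finite A" "\<Union>C \<subseteq> A"
  shows "\<exists>p. bij_betw p A {..<card A} \<and> (\<forall>X\<in>C. \<exists>a::nat. p ` X = {a..<a + card X})"
  using assms
proof (induction C arbitrary: A rule: finite_induct)
  case empty
  then show ?case using ex_bij_betw_finite_nat[of A] by (auto simp: lessThan_atLeast0)
next
  case (insert X C)
  define A' where "A' = A - X"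
  have XA: "X \<subseteq> A" and finX: "finite X" using insert.prems finite_subset by auto
  have "Y \<inter> X = {}" if "Y \<in> C" for Y
    using insert.prems(1) insert.hyps(2) that by (auto simp: disjoint_def)
  then have sub: "\<Union>C \<subseteq> A'" using insert.prems(3) by (auto simp: A'_def)
  have "disjoint C" "finite A'" using insert.prems by (auto simp: disjoint_def A'_def)
  from insert.IH[OF this sub] obtain p where p: "bij_betw p A' {..<card A'}"
    "\<forall>X\<in>C. \<exists>a. p ` X = {a..<a + card X}" by blast
  obtain r where r: "bij_betw r X {0..<card X}" using ex_bij_betw_finite_nat[OF finX] by blast
  define n where "n = card A'"
  define q where "q i = (if i \<in> A' then p i else n + r i)" for i
  have cardA: "card A = n + card X"
    using card_Diff_subset[OF finX XA] card_mono[OF insert.prems(2) XA] by (simp add: A'_def n_def)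
  have shift: "bij_betw (\<lambda>i. n + r i) X {n..<n + card X}"
    using bij_betw_trans[OF r, of "(+) n" "{n..<n + card X}"] by (simp add: bij_betw_def comp_def add.commute)
  have "bij_betw q (A' \<union> X) ({..<n} \<union> {n..<n + card X})"
    unfolding q_def by (rule bij_betw_disjoint_Un) (use p shift in \<open>auto simp: A'_def n_def\<close>)
  moreover have "A' \<union> X = A" "{..<n} \<union> {n..<n + card X} = {..<card A}"
    using XA cardA by (auto simp: A'_def)
  ultimately have "bij_betw q A {..<card A}" by simp
  moreover have "q ` X = {n..<n + card X}"
    using shift by (simp add: q_def A'_def bij_betw_def cong: image_cong)
  moreover have "q ` Y = p ` Y" if "Y \<in> C" for Y
    using sub that by (intro image_cong) (auto simp: q_def)
  ultimately show ?case using p(2) by (intro exI[of _ q]) auto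
qed

text \<open>
  \<open>p\<close> orders the coordinates so that the block \<open>X\<close> occupies an interval beginning at \<open>lo X\<close>, and
  \<open>\<nu>\<close> numbers the nodes along the path.
\<close>

locale block_layout = path_layout p \<nu> d
  for p :: "'d::finite \<Rightarrow> nat" and \<nu> :: "nat \<Rightarrow> 'n::finite" and d +
  fixes C C' :: "'d set set" and lo :: "'d set \<Rightarrow> nat"
  assumes blocks: "even_blocks C C'"
    and interval: "X \<in> C \<Longrightarrow> p ` X = {lo X..<lo X + card X}"
begin

definition chords :: "(nat \<times> nat) set" where
  "chords = (\<lambda>X. (lo X, lo X + card X)) ` C"

definition nat_arcs :: "(nat \<times> nat) set" where
  "nat_arcs = range (\<lambda>i. (p i, Suc (p i))) \<union> range (\<lambda>i. (Suc (p i), p i)) \<union>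
     (\<lambda>X. (lo X, lo X + card X)) ` C \<union> (\<lambda>X. (lo X + card X, lo X)) ` C'"

definition block_graph :: "'n pair_pre_digraph" where
  "block_graph = \<lparr>pverts = UNIV, parcs = (\<lambda>(a, b). (\<nu> a, \<nu> b)) ` nat_arcs\<rparr>"

lemma C'_subset: "C' \<subseteq> C"
  using blocks by (simp add: even_blocks_def)

lemma card_block: "X \<in> C \<Longrightarrow> 0 < card X" "X \<in> C \<Longrightarrow> even (card X)"
  using blocks by (auto simp: even_blocks_def card_gt_0_iff)

lemma block_end: assumes "X \<in> C" shows "lo X + card X \<le> d"
proof -
  have "lo X + card X - 1 \<in> p ` X" using interval[OF assms] card_block[OF assms] by auto
  then have "lo X + card X - 1 < d" using p_less by auto
  then show ?thesis by simp
qed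

lemma nonoverlapping_chords: "nonoverlapping chords"
proof -
  have "lo X + card X \<le> lo Y \<or> lo Y + card Y \<le> lo X" if "X \<in> C" "Y \<in> C" "X \<noteq> Y" for X Y
  proof (rule ccontr)
    assume "\<not> ?thesis"
    then have "max (lo X) (lo Y) \<in> p ` X \<inter> p ` Y"
      using interval[OF that(1)] interval[OF that(2)] card_block(1)[OF that(1)] card_block(1)[OF that(2)]
      by auto
    then have "X \<inter> Y \<noteq> {}" using p_eq_iff by auto
    then show False using blocks that by (auto simp: even_blocks_def disjoint_def)
  qed
  then show ?thesis using card_block(1) by (fastforce simp: nonoverlapping_def chords_def)
qed

lemma nat_arcs_bound:
  assumes "(a, b) \<in> nat_arcs"
  shows "a \<le> d" "b \<le> d" "a \<noteq> b"
proof -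
  have X: "lo X + card X \<le> d \<and> lo X \<le> d \<and> lo X \<noteq> lo X + card X" if "X \<in> C" for X
    using block_end[OF that] card_block(1)[OF that] by linarith
  have "a \<le> d \<and> b \<le> d \<and> a \<noteq> b"
    using assms unfolding nat_arcs_def
  proof (elim UnE imageE)
    fix i assume "(a, b) = (p i, Suc (p i))"
    then show ?thesis using p_less[of i] by auto
  next
    fix i assume "(a, b) = (Suc (p i), p i)"
    then show ?thesis using p_less[of i] by auto
  next
    fix X assume "(a, b) = (lo X, lo X + card X)" "X \<in> C"
    then show ?thesis using X[of X] by simp
  next
    fix X assume "(a, b) = (lo X + card X, lo X)" "X \<in> C'"
    then show ?thesis using X[of X] C'_subset by auto
  qed
  then show "a \<le> d" "b \<le> d" "a \<noteq> b" by auto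
qed

lemma nat_arcs_adj: "(a, b) \<in> nat_arcs \<Longrightarrow> chord_path_adj chords a b"
  using C'_subset by (auto simp: nat_arcs_def chord_path_adj_def chords_def)

lemma path_edges_block_vertices:
  "path_edges p \<nu> ` block_vertices C C' = {axis i 1 - axis j 1 |i j. (i, j) \<in> parcs block_graph}"
proof -
  define e where "e = (\<lambda>(a, b). axis (\<nu> a) 1 - axis (\<nu> b) 1 :: real ^ 'n)"
  have ax: "path_edges p \<nu> (axis i 1) = e (p i, Suc (p i))" for i
    by (simp add: e_def path_edges_axis)
  have neg: "path_edges p \<nu> (- x) = - path_edges p \<nu> x" for x
    by (rule linear_neg[OF linear_path_edges])
  have bl: "path_edges p \<nu> (ind_vec X) = e (lo X, lo X + card X)" if "X \<in> C" for X
    using path_edges_interval[OF interval[OF that]] block_end[OF that] by (simp add: e_def)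
  have swap: "- e (a, b) = e (b, a)" for a b by (simp add: e_def)
  have "path_edges p \<nu> ` block_vertices C C' = e ` nat_arcs"
    using C'_subset unfolding block_vertices_def nat_arcs_def image_Un image_image
    by (intro arg_cong2[of _ _ _ _ "(\<union>)"] image_cong refl) (auto simp: ax neg bl swap)
  also have "\<dots> = {axis i 1 - axis j 1 |i j. (i, j) \<in> parcs block_graph}"
    by (force simp: block_graph_def e_def)
  finally show ?thesis .
qed

lemma pair_digraph_block_graph: "pair_digraph block_graph"
  using nat_arcs_bound \<nu>_eq_iff
  by unfold_locales (auto simp: block_graph_def)

lemma path_arcs:
  assumes "l < d"
  shows "(\<nu> l, \<nu> (Suc l)) \<in> parcs block_graph" "(\<nu> (Suc l), \<nu> l) \<in> parcs block_graph"
proof -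
  have "l \<in> range p" using p assms by (simp add: bij_betw_def)
  then obtain i where "l = p i" by auto
  then show "(\<nu> l, \<nu> (Suc l)) \<in> parcs block_graph" "(\<nu> (Suc l), \<nu> l) \<in> parcs block_graph"
    by (force simp: block_graph_def nat_arcs_def)+
qed

lemma block_graph_reachable: "reachable (with_proj block_graph) x y"
proof -
  interpret pair_digraph block_graph by (rule pair_digraph_block_graph)
  let ?R = "reachable (with_proj block_graph)"
  have U: "pverts block_graph = UNIV" by (simp add: block_graph_def)
  have "?R (\<nu> 0) (\<nu> l) \<and> ?R (\<nu> l) (\<nu> 0)" if "l \<le> d" for l
    using that
  proof (induction l)
    case (Suc l)
    then have arc: "(\<nu> l, \<nu> (Suc l)) \<in> parcs block_graph"
      "(\<nu> (Suc l), \<nu> l) \<in> parcs block_graph" using path_arcs[of l] by simp_all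
    have reach: "?R (\<nu> 0) (\<nu> l)" "?R (\<nu> l) (\<nu> 0)" using Suc by simp_all
    show ?case
      using reachable_adj_trans[OF reach(1) arc(1)] adj_reachable_trans[OF arc(2) reach(2)]
      by (rule conjI)
  qed (simp add: U)
  moreover obtain a b where "a \<le> d" "x = \<nu> a" "b \<le> d" "y = \<nu> b"
    using \<nu> unfolding bij_betw_def by (metis UNIV_I atMost_iff imageE)
  ultimately show ?thesis by (metis reachable_trans)
qed

lemma connected_block_graph: "Digraph_Component.connected (with_proj block_graph)"
proof -
  interpret pair_digraph block_graph by (rule pair_digraph_block_graph)
  show ?thesis unfolding connected_def
    by (rule strongly_connectedI)
      (auto simp: block_graph_reachable reachable_mk_symmetricI, simp add: block_graph_def)
qed

text \<open>
  By strong connectivity, an arc is completed to a cycle by a simple path from its head to its tail.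
\<close>

lemma all_arcs_in_cycles_block_graph: "all_arcs_in_cycles block_graph"
  unfolding all_arcs_in_cycles_def
proof
  interpret pair_digraph block_graph by (rule pair_digraph_block_graph)
  fix e assume e: "e \<in> parcs block_graph"
  obtain q where q: "apath (snd e) q (fst e)"
    using block_graph_reachable[of "snd e" "fst e"] apath_awalk_to_apath reachable_awalk by blast
  have "cycle (e # q)"
    unfolding cycle_def using q e by (intro exI[of _ "fst e"]) (auto simp: apath_def awalk_Cons_iff)
  then show "\<exists>p. cycle p \<and> e \<in> set p" by (intro exI[of _ "e # q"]) simp
qed

lemma no_even_cycle_block_graph: "\<not> has_even_cycle block_graph"
proof
  assume "has_even_cycle block_graph"
  then obtain q where q: "pre_digraph.cycle (with_proj (mk_symmetric (with_proj block_graph))) q"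
    and len: "even (length q)" "4 \<le> length q" by (auto simp: has_even_cycle_def)
  obtain s where s: "\<And>j k. s j = s k \<longleftrightarrow> int (length q) dvd j - k"
    "\<And>k. (s k, s (k + 1)) \<in> parcs (mk_symmetric (with_proj block_graph))"
    using cycle_as_periodic_sequence[OF q] by blast
  define \<tau> where "\<tau> = inv_into {..d} \<nu>"
  have \<tau>: "\<tau> (\<nu> a) = a" if "a \<le> d" for a
    using \<nu> that by (simp add: \<tau>_def bij_betw_def inv_into_f_f)
  have \<tau>_eq: "\<tau> x = \<tau> y \<longleftrightarrow> x = y" for x y
    using \<nu> unfolding \<tau>_def bij_betw_def by (metis UNIV_I f_inv_into_f)
  have adj: "chord_path_adj chords (\<tau> x) (\<tau> y)"
    if xy: "(x, y) \<in> parcs (mk_symmetric (with_proj block_graph))" for x y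
  proof -
    obtain a b where ab: "(a, b) \<in> nat_arcs" "(x, y) = (\<nu> a, \<nu> b) \<or> (x, y) = (\<nu> b, \<nu> a)"
      using xy by (auto simp: mk_symmetric_def block_graph_def)
    then show ?thesis
      using nat_arcs_adj[OF ab(1)] nat_arcs_bound[OF ab(1)] \<tau> by (auto simp: chord_path_adj_def)
  qed
  have "odd (length q)"
  proof (rule chord_path_cycle_odd[of _ "\<lambda>k. \<tau> (s k)"])
    show "3 \<le> length q" using len by simp
    show "\<tau> (s j) = \<tau> (s k) \<longleftrightarrow> int (length q) dvd j - k" for j k by (simp add: \<tau>_eq s(1))
    show "chord_path_adj chords (\<tau> (s k)) (\<tau> (s (k + 1)))" for k by (rule adj[OF s(2)])
    show "nonoverlapping chords" by (rule nonoverlapping_chords)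
    show "even (b - a)" if "(a, b) \<in> chords" for a b
      using that card_block by (auto simp: chords_def)
  qed
  then show False using len by simp
qed

end

lemma block_layout_exists:
  fixes C C' :: "'d::finite set set"
  assumes card: "CARD('n::finite) = CARD('d) + 1" and blocks: "even_blocks C C'"
  obtains p and \<nu> :: "nat \<Rightarrow> 'n::finite" and lo where "block_layout p \<nu> CARD('d) C C' lo"
proof -
  obtain p where p: "bij_betw p (UNIV :: 'd set) {..<CARD('d)}"
    "\<forall>X\<in>C. \<exists>a::nat. p ` X = {a..<a + card X}"
    using interval_layout[of C "UNIV :: 'd set"] blocks by (auto simp: even_blocks_def)
  obtain lo where lo: "\<And>X. X \<in> C \<Longrightarrow> p ` X = {lo X..<lo X + card X}" using p(2) by metis
  obtain \<nu> where \<nu>: "bij_betw \<nu> {..CARD('d)} (UNIV :: 'n set)"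
    using finite_same_card_bij[of "{..CARD('d)}" "UNIV :: 'n set"] card by auto
  have "block_layout p \<nu> CARD('d) C C' lo"
    by unfold_locales (use p \<nu> lo blocks in auto)
  then show thesis by (rule that)
qed

lemma axis_difference_eq_iff:
  assumes "i \<noteq> j" "axis i 1 - axis j 1 = (axis i' 1 - axis j' 1 :: real ^ 'n::finite)"
  shows "i = i' \<and> j = j'"
proof -
  have eq: "axis i 1 $ k - axis j 1 $ k = (axis i' 1 $ k - axis j' 1 $ k :: real)" for k
    using arg_cong[OF assms(2), of "\<lambda>x. x $ k"] by simp
  show ?thesis using eq[of i] eq[of j] assms(1) by (auto simp: axis_def split: if_splits)
qed

theorem pseudo_symmetric_smooth_fano_graph:
  fixes P :: "(real ^ 'd::finite) set"
  assumes card: "CARD('n::finite) = CARD('d) + 1"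
    and smooth: "smooth_fano_polytope P" and ps: "pseudo_symmetric P"
  obtains G :: "'n::finite pair_pre_digraph" where "pair_digraph G" "pverts G = UNIV"
    "Digraph_Component.connected (with_proj G)" "all_arcs_in_cycles G" "\<not> has_even_cycle G"
    "unimodularly_equivalent P (graph_polytope G)"
    "centrally_symmetric P \<longrightarrow> Digraph.symmetric (with_proj G)"
proof -
  obtain g C C' where g: "lattice_iso g" and blocks: "even_blocks C C'"
    and gV: "g ` vertices P = block_vertices C C'"
    using pseudo_symmetric_classification[OF smooth ps] by blast
  obtain p and \<nu> :: "nat \<Rightarrow> 'n" and lo where "block_layout p \<nu> CARD('d) C C' lo"
    using block_layout_exists[OF card blocks] by blast
  then interpret block_layout p \<nu> "CARD('d)" C C' lo .
  define f where "f = path_edges p \<nu> \<circ> g"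
  have lin: "linear f" and bij: "bij_betw f UNIV zero_sum_hyperplane"
    using g path_edges_bij unfolding f_def lattice_iso_def
    by (auto intro: linear_compose linear_path_edges bij_betw_trans)
  have lattice: "f ` int_lattice = zero_sum_hyperplane \<inter> int_lattice"
    using g path_edges_lattice by (simp add: f_def lattice_iso_def flip: image_image)
  have fV: "f ` vertices P = {axis i 1 - axis j 1 |i j. (i, j) \<in> parcs block_graph}"
    using path_edges_block_vertices gV by (metis f_def image_comp)
  have "P = convex hull (vertices P)"
    using smooth fano_polytopeD(4) by (auto simp: smooth_fano_polytope_def)
  then have "f ` P = graph_polytope block_graph"
    unfolding graph_polytope_def fV[symmetric] by (metis convex_hull_linear_image[OF lin])
  then have equiv: "unimodularly_equivalent P (graph_polytope block_graph)"
    unfolding unimodularly_equivalent_def using lin bij lattice by blast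
  have sym: "Digraph.symmetric (with_proj block_graph)" if "centrally_symmetric P"
  proof -
    have neg: "- x \<in> f ` vertices P" if "x \<in> f ` vertices P" for x
    proof -
      have "vertices P = uminus ` vertices P"
        using \<open>centrally_symmetric P\<close> vertices_uminus[of P] by (simp add: centrally_symmetric_def)
      then show ?thesis using that linear_neg[OF lin] by (metis (no_types, opaque_lifting) imageE imageI)
    qed
    have "(j, i) \<in> parcs block_graph" if ij: "(i, j) \<in> parcs block_graph" for i j
    proof -
      have "i \<noteq> j"
        using pair_loopfree_digraph.no_loops'[of block_graph i] pair_digraph_block_graph ij
        by (auto simp: pair_digraph_def)
      have "axis i 1 - axis j 1 \<in> f ` vertices P" using ij unfolding fV by blast
      from neg[OF this] obtain i' j' where "(i', j') \<in> parcs block_graph"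
        "axis j 1 - axis i 1 = (axis i' 1 - axis j' 1 :: real ^ 'n)"
        unfolding fV by auto
      then show ?thesis using axis_difference_eq_iff[of j i i' j'] \<open>i \<noteq> j\<close> by auto
    qed
    then show ?thesis by (auto simp: symmetric_def sym_def)
  qed
  show thesis
    by (rule that[OF pair_digraph_block_graph _ connected_block_graph
          all_arcs_in_cycles_block_graph no_even_cycle_block_graph equiv])
      (use sym in \<open>auto simp: block_graph_def\<close>)
qed

theorem theorem3p3:
  assumes "CARD('n::finite) = CARD('d::finite) + 1"
  shows
    "(\<forall>P :: (real ^ 'd) set. smooth_fano_polytope P \<and> centrally_symmetric P \<longrightarrow>
        (\<exists>G :: 'n pair_pre_digraph. pair_digraph G \<and> pverts G = UNIV \<and>
           Digraph.symmetric (with_proj G) \<and>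
           Digraph_Component.connected (with_proj G) \<and>
           \<not> has_even_cycle G \<and>
           unimodularly_equivalent P (graph_polytope G))) \<and>
     (\<forall>P :: (real ^ 'd) set. smooth_fano_polytope P \<and> pseudo_symmetric P \<longrightarrow>
        (\<exists>G :: 'n pair_pre_digraph. pair_digraph G \<and> pverts G = UNIV \<and>
           Digraph_Component.connected (with_proj G) \<and>
           all_arcs_in_cycles G \<and>
           \<not> has_even_cycle G \<and>
           unimodularly_equivalent P (graph_polytope G)))"
proof (intro conjI allI impI; elim conjE)
  fix P :: "(real ^ 'd) set"
  assume P: "smooth_fano_polytope P" "centrally_symmetric P"
  then have "pseudo_symmetric P"
    using centrally_symmetric_imp_pseudo_symmetric by (auto simp: smooth_fano_polytope_def)
  then show "\<exists>G :: 'n pair_pre_digraph. pair_digraph G \<and> pverts G = UNIV \<and>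
           Digraph.symmetric (with_proj G) \<and>
           Digraph_Component.connected (with_proj G) \<and>
           \<not> has_even_cycle G \<and>
           unimodularly_equivalent P (graph_polytope G)"
    using P by (metis pseudo_symmetric_smooth_fano_graph[OF assms P(1)])
next
  fix P :: "(real ^ 'd) set"
  assume P: "smooth_fano_polytope P" "pseudo_symmetric P"
  show "\<exists>G :: 'n pair_pre_digraph. pair_digraph G \<and> pverts G = UNIV \<and>
           Digraph_Component.connected (with_proj G) \<and>
           all_arcs_in_cycles G \<and>
           \<not> has_even_cycle G \<and>
           unimodularly_equivalent P (graph_polytope G)"
    by (metis pseudo_symmetric_smooth_fano_graph[OF assms P])
qed

end
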